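(* Let $X=Y=\mathbb R^{n}$ and $\hat\delta>0$. Suppose $\varphi_{\mathrm{logdet}}\in\mathrm{Diff}^2(X)$ is a minimizer over $\varphi\in\mathrm{Diff}^2(X)$ of the log-determinant-regularized loss $$\mathbb E_{(x,y^\delta)\sim p(x,y^\delta)}\left(\tfrac12\|\varphi(x)-y^\delta\|^2-\hat\delta^2\log|\det \mathrm D\varphi(x)|\right).$$ Then for all $x\in X$, $$\varphi_{\mathrm{logdet}}(x)=Ax-\hat\delta^2\,\nabla_y\bigl(\log (\varphi_{\mathrm{logdet}})_{\#}p_X\bigr)\bigl(\varphi_{\mathrm{logdet}}(x)\bigr),$$ where $(\varphi_{\mathrm{logdet}})_{\#}p_X$ denotes the density of the push-forward of the prior $p_X$ through $\varphi_{\mathrm{logdet}}$.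
   Context: $A:X\to X$ is a linear map on $X=\mathbb R^n$ and $\delta>0$. The prior $p_X:X\to\mathbb R_{>0}$ is a continuously differentiable, everywhere positive probability density. The joint law $p(x,y^\delta)$ is that of $x\sim p_X$ and $y^\delta=Ax+\eta$, where $\eta\sim\mathcal N(0,\delta^2 I)$ is independent of $x$. $\mathrm{Diff}^2(X)$ is the set of all bijective maps $\varphi\in C^2(X,X)$ whose inverse is also $C^2$; $\mathrm D\varphi$ is the Jacobian. The push-forward density is $\varphi_{\#}p_X(y)=p_X(\varphi^{-1}(y))\,|\det \mathrm D\varphi^{-1}(y)|$. Standing assumption: $p_X$ decays sufficiently fast that all expectations involved in the loss exist and are finite (the loss is considered on those $\varphi$ for which the expectations are finite). *)

theory Defs
  imports "HOL-Probability.Probability"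
begin

definition C1_map :: "('a::real_normed_vector \<Rightarrow> 'b::real_normed_vector) \<Rightarrow> bool" where
  "C1_map f \<longleftrightarrow>
    (\<exists>f' :: 'a \<Rightarrow> 'a \<Rightarrow>\<^sub>L 'b.
      (\<forall>x. (f has_derivative blinfun_apply (f' x)) (at x)) \<and> continuous_on UNIV f')"

definition C2_map :: "('a::real_normed_vector \<Rightarrow> 'b::real_normed_vector) \<Rightarrow> bool" where
  "C2_map f \<longleftrightarrow>
    (\<exists>f' :: 'a \<Rightarrow> 'a \<Rightarrow>\<^sub>L 'b.
      (\<forall>x. (f has_derivative blinfun_apply (f' x)) (at x)) \<and> C1_map f')"

definition Diff2 :: "('a::real_normed_vector \<Rightarrow> 'a) set" where
  "Diff2 = {\<phi>. bij \<phi> \<and> C2_map \<phi> \<and> C2_map (inv \<phi>)}"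

(* Only meaningful where f is differentiable; elsewhere the value is unspecified. *)
definition gradient :: "('a::real_inner \<Rightarrow> real) \<Rightarrow> 'a \<Rightarrow> 'a" where
  "gradient f x = (THE D. GDERIV f x :> D)"

definition pushforward_density ::
    "(real^'n \<Rightarrow> real^'n) \<Rightarrow> (real^'n \<Rightarrow> real) \<Rightarrow> real^'n \<Rightarrow> real" where
  "pushforward_density \<phi> p y = p (inv \<phi> y) * \<bar>det (jacobian (inv \<phi>) (at y))\<bar>"

(* The law N(0, \<delta>\<^sup>2 I): the coordinates are independent N(0, \<delta>\<^sup>2). The second argument of
   normal_density is the standard deviation, not the variance. *)
definition isotropic_gaussian :: "real \<Rightarrow> (real^'n) measure" where
  "isotropic_gaussian \<delta> =
    density lborel (\<lambda>z. ennreal (\<Prod>i\<in>UNIV. normal_density 0 \<delta> (z $ i)))"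

(* The law of (x, A x + \<eta>) with independent x, \<eta>, where x has density p and \<eta> is N(0, \<delta>\<^sup>2 I). *)
definition joint_law ::
    "(real^'n \<Rightarrow> real^'n) \<Rightarrow> real \<Rightarrow> (real^'n \<Rightarrow> real) \<Rightarrow> ((real^'n) \<times> (real^'n)) measure" where
  "joint_law A \<delta> p =
    distr (density lborel (\<lambda>x. ennreal (p x)) \<Otimes>\<^sub>M isotropic_gaussian \<delta>) borel
      (\<lambda>(x, \<eta>). (x, A x + \<eta>))"

definition logdet_integrand ::
    "real \<Rightarrow> (real^'n \<Rightarrow> real^'n) \<Rightarrow> (real^'n) \<times> (real^'n) \<Rightarrow> real" where
  "logdet_integrand \<delta>' \<phi> = (\<lambda>(x, y).
    1 / 2 * (norm (\<phi> x - y))\<^sup>2 - \<delta>'\<^sup>2 * ln \<bar>det (jacobian \<phi> (at x))\<bar>)"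

definition logdet_loss ::
    "(real^'n \<Rightarrow> real^'n) \<Rightarrow> real \<Rightarrow> (real^'n \<Rightarrow> real) \<Rightarrow> real \<Rightarrow> (real^'n \<Rightarrow> real^'n) \<Rightarrow> real" where
  "logdet_loss A \<delta> p \<delta>' \<phi> = integral\<^sup>L (joint_law A \<delta> p) (logdet_integrand \<delta>' \<phi>)"

(* The Bochner integral of a non-integrable function is 0, so the loss is only compared on those
   \<phi> for which its expectation exists and is finite. *)
definition logdet_admissible ::
    "(real^'n \<Rightarrow> real^'n) \<Rightarrow> real \<Rightarrow> (real^'n \<Rightarrow> real) \<Rightarrow> real \<Rightarrow> (real^'n \<Rightarrow> real^'n) set" where
  "logdet_admissible A \<delta> p \<delta>' =
    {\<phi> \<in> Diff2. integrable (joint_law A \<delta> p) (logdet_integrand \<delta>' \<phi>)}"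

end

theory Submission
  imports Defs "HOL-Real_Asymp.Real_Asymp"
begin

text \<open>
  Compare the minimizer \<open>\<phi>\<close> with the inner variations \<open>\<phi> \<circ> S\<^sub>t\<close>, \<open>S\<^sub>t x = x + t g(x) e\<^sub>k\<close>, where \<open>g\<close> is a
  compactly supported bump. For small \<open>t\<close> these are again in \<open>Diff2\<close>, the Jacobian determinant of \<open>S\<^sub>t\<close>
  is \<open>1 + t \<partial>\<^sub>kg\<close>, and the change of the loss is the integral of a compactly supported function of \<open>x\<close>
  against \<open>p\<close>, because the noise has mean zero. Differentiating at \<open>t = 0\<close>, integrating \<open>p \<partial>\<^sub>kg\<close> by parts and
  localizing \<open>g\<close> yields, with \<open>w = ln |det D\<phi>|\<close>,
  \<open>(\<phi> x - A x) \<bullet> D\<phi>(x) v = - \<delta>'\<^sup>2 D(ln p - w)(x) v\<close> for all \<open>v\<close>.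
  Since \<open>ln p - w\<close> is the log-density of the push-forward composed with \<open>\<phi>\<close>, the claim follows on
  cancelling the invertible map \<open>D\<phi>(x)\<close>. Inner rather than outer variations make a nonlinear change
  of variables in the integral unnecessary.
\<close>

section \<open>Calculus of \<open>C\<^sup>1\<close> and \<open>C\<^sup>2\<close> maps\<close>

text \<open>In finite dimension, continuity of \<open>f' x h\<close> in \<open>x\<close> for each
  fixed \<open>h\<close> already gives continuity in operator norm, so it suffices to check one
  direction at a time.\<close>

lemma C1_mapI:
  fixes f :: "'a::euclidean_space \<Rightarrow> 'b::real_normed_vector"
  assumes "\<And>x. (f has_derivative f' x) (at x)"
    and "\<And>h. continuous_on UNIV (\<lambda>x. f' x h)"
  shows "C1_map f"
  unfolding C1_map_def
proof (intro exI conjI allI)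
  have bl: "bounded_linear (f' x)" for x
    using assms(1) has_derivative_bounded_linear by blast
  show "(f has_derivative blinfun_apply (Blinfun (f' x))) (at x)" for x
    using assms(1) bl by (simp add: bounded_linear_Blinfun_apply)
  show "continuous_on UNIV (\<lambda>x. Blinfun (f' x))"
    by (rule continuous_on_blinfun_componentwise) (simp add: bounded_linear_Blinfun_apply bl assms(2))
qed

lemma C1_mapE:
  assumes "C1_map f"
  obtains f' where "\<And>x. (f has_derivative f' x) (at x)"
    and "\<And>h. continuous_on UNIV h \<Longrightarrow> continuous_on UNIV (\<lambda>x. f' x (h x))"
proof -
  from assms obtain f' where f': "\<And>x. (f has_derivative blinfun_apply (f' x)) (at x)"
    "continuous_on UNIV f'"
    unfolding C1_map_def by blast
  show thesis
    by (rule that[of "\<lambda>x. blinfun_apply (f' x)"]) (auto intro!: f' continuous_intros)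
qed

text \<open>Derivatives are unique, so the continuity carries over to any derivative named
  elsewhere. The direction may vary with \<open>x\<close>, as it does in
  \<open>g x *\<^sub>R a\<close>.\<close>

lemma C1_map_continuous_on_derivative:
  assumes "C1_map f" "\<And>x. (f has_derivative f' x) (at x)" "continuous_on UNIV h"
  shows "continuous_on UNIV (\<lambda>x. f' x (h x))"
proof -
  obtain f'' where f'': "\<And>x. (f has_derivative f'' x) (at x)"
    "\<And>h. continuous_on UNIV h \<Longrightarrow> continuous_on UNIV (\<lambda>x. f'' x (h x))"
    using assms(1) by (elim C1_mapE) blast
  have "f'' x = f' x" for x
    by (rule has_derivative_unique[OF f''(1) assms(2)])
  then show ?thesis
    using f''(2)[OF assms(3)] by simp
qed

lemma C1_map_continuous_on:
  assumes "C1_map f"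
  shows "continuous_on S f"
proof -
  from assms obtain f' where "\<And>x. (f has_derivative f' x) (at x)"
    by (meson C1_mapE)
  then show ?thesis
    by (metis continuous_at_imp_continuous_on has_derivative_continuous)
qed

lemma C1_map_bounded_linear:
  assumes "bounded_linear f"
  shows "C1_map f"
  unfolding C1_map_def
  by (rule exI[of _ "\<lambda>_. Blinfun f"])
    (auto simp: bounded_linear_Blinfun_apply assms bounded_linear_imp_has_derivative)

lemma C1_map_const: "C1_map (\<lambda>_. c)"
  unfolding C1_map_def by (rule exI[of _ "\<lambda>_. 0"]) (auto simp: zero_blinfun.rep_eq)

lemma C1_map_compose:
  assumes "C1_map f" "C1_map g"
  shows "C1_map (\<lambda>x. f (g x))"
proof -
  obtain f' where f': "\<And>x. (f has_derivative blinfun_apply (f' x)) (at x)" "continuous_on UNIV f'"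
    using assms(1) unfolding C1_map_def by blast
  obtain g' where g': "\<And>x. (g has_derivative blinfun_apply (g' x)) (at x)" "continuous_on UNIV g'"
    using assms(2) unfolding C1_map_def by blast
  show ?thesis
    unfolding C1_map_def
  proof (intro exI conjI allI)
    show "((\<lambda>x. f (g x)) has_derivative blinfun_apply (f' (g x) o\<^sub>L g' x)) (at x)" for x
      by (rule has_derivative_eq_rhs[OF has_derivative_compose[OF g'(1) f'(1)]]) (simp add: fun_eq_iff)
    have "continuous_on UNIV (\<lambda>x. f' (g x))"
      by (rule continuous_on_compose2[OF f'(2) C1_map_continuous_on[OF assms(2)]]) auto
    then show "continuous_on UNIV (\<lambda>x. f' (g x) o\<^sub>L g' x)"
      by (intro continuous_intros g')
  qed
qed

lemma C1_map_add:
  assumes "C1_map f" "C1_map g"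
  shows "C1_map (\<lambda>x. f x + g x)"
proof -
  obtain f' where f': "\<And>x. (f has_derivative blinfun_apply (f' x)) (at x)" "continuous_on UNIV f'"
    using assms(1) unfolding C1_map_def by blast
  obtain g' where g': "\<And>x. (g has_derivative blinfun_apply (g' x)) (at x)" "continuous_on UNIV g'"
    using assms(2) unfolding C1_map_def by blast
  show ?thesis
    unfolding C1_map_def
  proof (intro exI conjI allI)
    show "((\<lambda>x. f x + g x) has_derivative blinfun_apply (f' x + g' x)) (at x)" for x
      using has_derivative_add[OF f'(1) g'(1)] by (simp add: plus_blinfun.rep_eq)
  qed (intro continuous_intros f' g')
qed

lemma C1_map_bilinear:
  assumes "bounded_bilinear B" "C1_map f" "C1_map g"
  shows "C1_map (\<lambda>x. B (f x) (g x))"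
proof -
  interpret bounded_bilinear B by fact
  obtain f' where f': "\<And>x. (f has_derivative blinfun_apply (f' x)) (at x)" "continuous_on UNIV f'"
    using assms(2) unfolding C1_map_def by blast
  obtain g' where g': "\<And>x. (g has_derivative blinfun_apply (g' x)) (at x)" "continuous_on UNIV g'"
    using assms(3) unfolding C1_map_def by blast
  show ?thesis
    unfolding C1_map_def
  proof (intro exI conjI allI)
    show "((\<lambda>x. B (f x) (g x)) has_derivative
        blinfun_apply ((prod_right (f x) o\<^sub>L g' x) + (prod_left (g x) o\<^sub>L f' x))) (at x)" for x
      by (rule has_derivative_eq_rhs[OF FDERIV[OF f'(1) g'(1)]])
        (simp add: fun_eq_iff plus_blinfun.rep_eq prod_right.rep_eq prod_left.rep_eq)
    have c: "continuous_on UNIV (\<lambda>x. prod_right (f x))" "continuous_on UNIV (\<lambda>x. prod_left (g x))"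
      using C1_map_continuous_on assms(2,3)
      by (auto intro!: bounded_linear.continuous_on[OF bounded_linear_prod_right]
          bounded_linear.continuous_on[OF bounded_linear_prod_left])
    show "continuous_on UNIV (\<lambda>x. (prod_right (f x) o\<^sub>L g' x) + (prod_left (g x) o\<^sub>L f' x))"
      by (intro continuous_intros f' g' c)
  qed
qed

lemma C1_map_linear_compose:
  assumes "bounded_linear L" "C1_map g"
  shows "C1_map (\<lambda>x. L (g x))"
  using C1_map_compose[OF C1_map_bounded_linear[OF assms(1)] assms(2)] .

lemma C1_map_sum:
  assumes "\<And>i. i \<in> I \<Longrightarrow> C1_map (f i)"
  shows "C1_map (\<lambda>x. \<Sum>i\<in>I. f i x)"
  using assms by (induction I rule: infinite_finite_induct) (auto intro: C1_map_const C1_map_add)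

lemma C1_map_mult:
  fixes f g :: "'a::real_normed_vector \<Rightarrow> 'b::real_normed_algebra"
  shows "C1_map f \<Longrightarrow> C1_map g \<Longrightarrow> C1_map (\<lambda>x. f x * g x)"
  by (rule C1_map_bilinear[OF bounded_bilinear_mult])

lemma C1_map_prod:
  fixes f :: "'i \<Rightarrow> 'a::real_normed_vector \<Rightarrow> 'b::real_normed_field"
  assumes "\<And>i. i \<in> I \<Longrightarrow> C1_map (f i)"
  shows "C1_map (\<lambda>x. \<Prod>i\<in>I. f i x)"
  using assms by (induction I rule: infinite_finite_induct) (auto intro: C1_map_const C1_map_mult)

text \<open>Chain rule with the conditions on \<open>u\<close> imposed only on the range of
  \<open>f\<close>; this admits outer functions that are singular at 0, such as
  \<open>inverse\<close> and \<open>ln\<close>.\<close>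

lemma C1_map_real_compose:
  fixes f :: "'a::euclidean_space \<Rightarrow> real"
  assumes "C1_map f"
    and "\<And>x. (u has_real_derivative u' (f x)) (at (f x))"
    and "\<And>x. isCont u' (f x)"
  shows "C1_map (\<lambda>x. u (f x))"
proof -
  obtain f' where f': "\<And>x. (f has_derivative f' x) (at x)"
    "\<And>h. continuous_on UNIV h \<Longrightarrow> continuous_on UNIV (\<lambda>x. f' x (h x))"
    using assms(1) by (elim C1_mapE) blast
  show ?thesis
  proof (rule C1_mapI)
    show "((\<lambda>x. u (f x)) has_derivative (\<lambda>h. u' (f x) * f' x h)) (at x)" for x
      using has_derivative_compose[OF f'(1), of u "(*) (u' (f x))" x] assms(2)[of x]
      by (simp add: has_field_derivative_def)
    have "isCont f x" for x
      using f'(1) has_derivative_continuous by blast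
    then have "isCont (\<lambda>x. u' (f x)) x" for x
      using assms(3) by (rule isCont_o2)
    then show "continuous_on UNIV (\<lambda>x. u' (f x) * f' x h)" for h
      by (intro continuous_intros f') (auto simp: continuous_on_eq_continuous_at)
  qed
qed

lemma C1_map_inverse:
  fixes f :: "'a::euclidean_space \<Rightarrow> real"
  assumes "C1_map f" "\<And>x. f x \<noteq> 0"
  shows "C1_map (\<lambda>x. inverse (f x))"
  by (rule C1_map_real_compose[OF assms(1), where u' = "\<lambda>x. - (inverse x ^ Suc (Suc 0))"])
    (use assms(2) DERIV_inverse in \<open>auto intro!: continuous_intros simp del: power_Suc\<close>)

lemma C1_map_ln_abs:
  fixes f :: "'a::euclidean_space \<Rightarrow> real"
  assumes "C1_map f" "\<And>x. f x \<noteq> 0"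
  shows "C1_map (\<lambda>x. ln \<bar>f x\<bar>)"
proof (rule C1_map_real_compose[OF assms(1), where u' = inverse and u = "\<lambda>x. ln \<bar>x\<bar>"])
  \<comment> \<open>Squaring removes the absolute value, so one computation covers both signs. At 0
    the identity rests on the convention \<open>ln 0 = 0\<close>.\<close>
  have "(\<lambda>x::real. ln \<bar>x\<bar>) = (\<lambda>x. ln (x\<^sup>2) / 2)"
  proof
    show "ln \<bar>x\<bar> = ln (x\<^sup>2) / 2" for x :: real
      using ln_realpow[of "\<bar>x\<bar>" 2] by (cases "x = 0") simp_all
  qed
  moreover have "((\<lambda>x. ln (x\<^sup>2) / 2) has_real_derivative inverse y) (at y)" if "y \<noteq> 0" for y :: real
    using that by (auto intro!: derivative_eq_intros simp: power2_eq_square field_simps zero_less_mult_iff)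
  ultimately have "((\<lambda>x. ln \<bar>x\<bar>) has_real_derivative inverse y) (at y)" if "y \<noteq> 0" for y :: real
    using that by simp
  then show "((\<lambda>x. ln \<bar>x\<bar>) has_real_derivative inverse (f x)) (at (f x))" for x
    using assms(2) by blast
qed (auto intro!: continuous_intros simp: assms(2))

section \<open>Maps of class C^2 and diffeomorphisms\<close>

lemma C2_mapD:
  assumes "C2_map f"
  obtains f' where "\<And>x. (f has_derivative blinfun_apply (f' x)) (at x)" "C1_map f'"
  using assms unfolding C2_map_def by blast

lemma C2_map_imp_C1_map: "C2_map f \<Longrightarrow> C1_map f"
  unfolding C2_map_def C1_map_def[of f] using C1_map_continuous_on by blast

lemma C2_map_compose:
  assumes "C2_map f" "C2_map g"
  shows "C2_map (\<lambda>x. f (g x))"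
proof -
  obtain f' where f': "\<And>x. (f has_derivative blinfun_apply (f' x)) (at x)" "C1_map f'"
    using C2_mapD[OF assms(1)] by blast
  obtain g' where g': "\<And>x. (g has_derivative blinfun_apply (g' x)) (at x)" "C1_map g'"
    using C2_mapD[OF assms(2)] by blast
  show ?thesis
    unfolding C2_map_def
  proof (intro exI conjI allI)
    show "((\<lambda>x. f (g x)) has_derivative blinfun_apply (f' (g x) o\<^sub>L g' x)) (at x)" for x
      by (rule has_derivative_eq_rhs[OF has_derivative_compose[OF g'(1) f'(1)]]) (simp add: fun_eq_iff)
    show "C1_map (\<lambda>x. f' (g x) o\<^sub>L g' x)"
      by (intro C1_map_bilinear[OF bounded_bilinear_blinfun_compose] g' C1_map_compose[OF f'(2)]
          C2_map_imp_C1_map assms)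
  qed
qed

lemma Diff2_compose:
  assumes "f \<in> Diff2" "g \<in> Diff2"
  shows "(\<lambda>x. f (g x)) \<in> Diff2"
proof -
  have "bij (f \<circ> g)" "inv (f \<circ> g) = inv g \<circ> inv f"
    using assms by (auto simp: Diff2_def bij_comp o_inv_distrib)
  then show ?thesis
    using assms by (auto simp: Diff2_def comp_def C2_map_compose)
qed

section \<open>Jacobian determinants\<close>

lemma jacobian_eq_matrix:
  assumes "(f has_derivative f') (at x)"
  shows "jacobian f (at x) = matrix f'"
  using assms frechet_derivative_at unfolding jacobian_def by metis

text \<open>By Leibniz's formula the determinant is a polynomial in the matrix entries, and these
  are bounded linear functionals of the C^1 map \<open>f'\<close>.\<close>

lemma C1_map_det_jacobian:
  fixes f :: "real^'n \<Rightarrow> real^'n"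
  assumes "C2_map f"
  shows "C1_map (\<lambda>x. det (jacobian f (at x)))"
proof -
  obtain f' where f': "\<And>x. (f has_derivative blinfun_apply (f' x)) (at x)" "C1_map f'"
    using C2_mapD[OF assms(1)] by blast
  have bl: "bounded_linear (\<lambda>B :: (real^'n) \<Rightarrow>\<^sub>L (real^'n). blinfun_apply B (axis j 1) $ i)" for i j
    by (intro bounded_linear_compose[OF bounded_linear_vec_nth] bounded_linear_intros)
  have "C1_map (\<lambda>x. \<Sum>\<pi> | \<pi> permutes (UNIV::'n set).
     of_int (sign \<pi>) * (\<Prod>i\<in>UNIV. blinfun_apply (f' x) (axis (\<pi> i) 1) $ i))"
    by (intro C1_map_sum C1_map_mult C1_map_prod C1_map_const C1_map_linear_compose[OF bl] f')
  then show ?thesis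
    by (simp add: jacobian_eq_matrix[OF f'(1)] det_def matrix_def)
qed

lemma det_jacobian_compose:
  fixes f g :: "real^'n \<Rightarrow> real^'n"
  assumes "f differentiable (at (g x))" "g differentiable (at x)"
  shows "det (jacobian (\<lambda>x. f (g x)) (at x)) = det (jacobian f (at (g x))) * det (jacobian g (at x))"
proof -
  obtain f' g' where d: "(f has_derivative f') (at (g x))" "(g has_derivative g') (at x)"
    using assms by (auto simp: differentiable_def)
  have "((\<lambda>x. f (g x)) has_derivative f' \<circ> g') (at x)"
    using has_derivative_compose[OF d(2,1)] by (simp add: comp_def)
  then have "jacobian (\<lambda>x. f (g x)) (at x) = jacobian f (at (g x)) ** jacobian g (at x)"
    using d matrix_compose by (metis has_derivative_linear jacobian_eq_matrix)
  then show ?thesis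
    by (simp add: det_mul)
qed

lemma Diff2_C1:
  assumes "f \<in> Diff2"
  shows "C1_map f" "C1_map (inv f)" "f differentiable (at x)" "inv f differentiable (at x)"
proof -
  show "C1_map f" "C1_map (inv f)"
    using assms by (auto simp: Diff2_def C2_map_imp_C1_map)
  then show "f differentiable (at x)" "inv f differentiable (at x)"
    by (auto simp: C1_map_def differentiable_def)
qed

text \<open>Chain rule applied to \<open>f (inv f x) = x\<close>. It yields the non-vanishing of the
  determinant and, later, the log-density of the push-forward.\<close>

lemma det_jacobian_inv:
  fixes f :: "real^'n \<Rightarrow> real^'n"
  assumes "f \<in> Diff2"
  shows "det (jacobian f (at (inv f y))) * det (jacobian (inv f) (at y)) = 1"
proof -
  have "(\<lambda>x. f (inv f x)) = (\<lambda>x. x)"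
    using assms by (auto simp: Diff2_def bij_is_surj surj_f_inv_f)
  then show ?thesis
    using det_jacobian_compose[of f "inv f" y] Diff2_C1[OF assms]
    by (simp add: jacobian_eq_matrix[OF has_derivative_ident] matrix_id_mat_1[unfolded id_def])
qed

lemma det_jacobian_nonzero:
  fixes f :: "real^'n \<Rightarrow> real^'n"
  assumes "f \<in> Diff2"
  shows "det (jacobian f (at x)) \<noteq> 0"
  using det_jacobian_inv[OF assms, of "f x"] assms
  by (auto simp: Diff2_def bij_is_inj inv_f_f)

section \<open>Shears\<close>

lemma derivative_inner_bound_imp_lipschitz:
  fixes g :: "'a::real_inner \<Rightarrow> real"
  assumes "\<And>x. GDERIV g x :> G x" "\<And>x. norm (G x) \<le> B"
  shows "\<bar>g x - g y\<bar> \<le> B * norm (x - y)"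
proof -
  have "onorm (\<lambda>h. h \<bullet> G z) \<le> B" for z
  proof (rule onorm_bound)
    show "norm (h \<bullet> G z) \<le> B * norm h" for h
      using Cauchy_Schwarz_ineq2[of h "G z"] mult_left_mono[OF assms(2)[of z], of "norm h"]
      by (simp add: mult.commute)
  qed (use assms(2)[of z] norm_ge_zero[of "G z"] in linarith)
  then have "norm (g x - g y) \<le> B * norm (x - y)"
    using assms(1) by (intro differentiable_bound[of UNIV g "\<lambda>x h. h \<bullet> G x"]) (auto simp: gderiv_def)
  then show ?thesis by simp
qed

text \<open>Solving \<open>y = x + u x\<close> for \<open>x\<close> means finding a fixed point of
  the contraction \<open>\<lambda>x. y - u x\<close>, which Banach's theorem supplies
  uniquely.\<close>

lemma bij_add_contraction:
  fixes u :: "'a::banach \<Rightarrow> 'a"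
  assumes "0 \<le> c" "c < 1" and lip: "\<And>x y. norm (u x - u y) \<le> c * norm (x - y)"
  shows "bij (\<lambda>x. x + u x)"
proof -
  have "\<exists>!x. y = x + u x" for y
  proof -
    have "\<exists>!x. y - u x = x"
      using lip by (intro banach_fix_type[OF assms(1,2)]) (simp add: dist_norm norm_minus_commute)
    then show ?thesis
      by (simp add: algebra_simps eq_commute)
  qed
  then show ?thesis
    unfolding bij_iff by (metis (no_types))
qed

text \<open>Subtracting the equations \<open>v y + u (v y) = y\<close> at two points and absorbing
  the contraction term shows the inverse to be Lipschitz with constant \<open>1 / (1 - c)\<close>.
  Its continuity is what the differentiation of the inverse starts from.\<close>

lemma continuous_inv_add_contraction:
  fixes u :: "'a::banach \<Rightarrow> 'a"
  assumes "0 \<le> c" "c < 1" and lip: "\<And>x y. norm (u x - u y) \<le> c * norm (x - y)"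
  shows "isCont (inv (\<lambda>x. x + u x)) y"
proof -
  define v where "v = inv (\<lambda>x. x + u x)"
  have bij: "bij (\<lambda>x. x + u x)"
    using assms by (rule bij_add_contraction)
  have v: "v y + u (v y) = y" for y
    using surj_f_inv_f[OF bij_is_surj[OF bij], of y] by (simp add: v_def)
  have "norm (v x - v y) \<le> norm (x - y) / (1 - c)" for x y
  proof -
    have "v x - v y = (x - y) - (u (v x) - u (v y))"
      using v[of x] v[of y] by (simp add: algebra_simps)
    then have "norm (v x - v y) \<le> norm (x - y) + c * norm (v x - v y)"
      using lip[of "v x" "v y"] norm_triangle_ineq4[of "x - y" "u (v x) - u (v y)"] by simp
    then show ?thesis
      using assms(2) by (simp add: field_simps)
  qed
  then have "(1 / (1 - c))-lipschitz_on UNIV v"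
    using assms(2) by (intro lipschitz_onI) (auto simp: dist_norm)
  then show ?thesis
    using lipschitz_on_continuous_on continuous_on_eq_continuous_at unfolding v_def by blast
qed

text \<open>The derivative of the map below is a rank one perturbation of the identity, so the derivative
  of its inverse is explicit (Sherman-Morrison) and inherits the regularity of the gradient.\<close>

lemma shear_Diff2:
  fixes g :: "'a::euclidean_space \<Rightarrow> real"
  assumes g: "\<And>x. GDERIV g x :> G x" and G: "C1_map G"
    and B: "\<And>x. norm (G x) \<le> 1 / 2" and a: "norm a = 1"
  shows "(\<lambda>x. x + g x *\<^sub>R a) \<in> Diff2"
proof -
  define S where "S = (\<lambda>x. x + g x *\<^sub>R a)"
  have lip: "norm (g x *\<^sub>R a - g y *\<^sub>R a) \<le> 1 / 2 * norm (x - y)" for x y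
    using derivative_inner_bound_imp_lipschitz[OF g B, of x y]
    by (simp add: a flip: scaleR_left_diff_distrib)
  have bij: "bij S"
    unfolding S_def by (rule bij_add_contraction[OF _ _ lip]) auto
  have cont: "isCont (inv S) y" for y
    unfolding S_def by (rule continuous_inv_add_contraction[OF _ _ lip]) auto
  have inv: "S (inv S y) = y" for y
    using bij by (simp add: bij_is_surj surj_f_inv_f)
  \<comment> \<open>\<open>T u\<close> is the rank one operator
    \<open>\<lambda>v. (v \<bullet> u) *\<^sub>R a\<close>, so the derivative of \<open>S\<close> at
    \<open>x\<close> is the identity plus \<open>T (G x)\<close>.\<close>
  define T where "T = (\<lambda>u :: 'a. blinfun_scaleR_left a o\<^sub>L blinfun_inner_left u)"
  have T_apply: "blinfun_apply (T u) v = (v \<bullet> u) *\<^sub>R a" for u v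
    by (simp add: T_def blinfun_inner_left.rep_eq)
  have T_C1: "C1_map (\<lambda>x. T (H x))" if "C1_map H" for H :: "'a \<Rightarrow> 'a"
    unfolding T_def
    by (intro C1_map_bilinear[OF bounded_bilinear_blinfun_compose] C1_map_const
        C1_map_linear_compose[OF bounded_linear_blinfun_inner_left] that)
  have der: "(S has_derivative blinfun_apply (id_blinfun + T (G x))) (at x)" for x
    using g[of x] unfolding S_def gderiv_def
    by (auto intro!: derivative_eq_intros simp: plus_blinfun.rep_eq T_apply fun_eq_iff)
  have C2: "C2_map S"
    unfolding C2_map_def
  proof (intro exI conjI allI)
    show "(S has_derivative blinfun_apply (id_blinfun + T (G x))) (at x)" for x
      by (rule der)
    show "C1_map (\<lambda>x. id_blinfun + T (G x))"
      by (intro C1_map_add C1_map_const T_C1 G)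
  qed
  \<comment> \<open>Sherman-Morrison: the inverse of \<open>id + T u\<close> is
    \<open>id - T (u / (1 + a \<bullet> u))\<close>. The bound 1/2 on the gradient keeps the
    denominator away from 0.\<close>
  define H where "H = (\<lambda>x. inverse (1 + a \<bullet> G x) *\<^sub>R G x)"
  have pos: "1 + a \<bullet> G x > 0" for x
  proof -
    have "\<bar>a \<bullet> G x\<bar> \<le> 1 / 2"
      using Cauchy_Schwarz_ineq2[of a "G x"] B[of x] a by simp
    then show ?thesis by linarith
  qed
  have H: "C1_map H"
    unfolding H_def
    by (intro C1_map_bilinear[OF bounded_bilinear_scaleR] G C1_map_inverse C1_map_add C1_map_const
        C1_map_linear_compose[OF bounded_linear_inner_right]) (use pos in \<open>metis less_irrefl\<close>)
  have der_inv: "(inv S has_derivative blinfun_apply (id_blinfun - T (H (inv S y)))) (at y)" for y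
  proof (rule has_derivative_inverse_basic[OF der _ _ cont open_UNIV UNIV_I inv])
    let ?x = "inv S y"
    have "v + (v \<bullet> G ?x) *\<^sub>R a - ((v + (v \<bullet> G ?x) *\<^sub>R a) \<bullet> H ?x) *\<^sub>R a = v" for v
      using pos[of ?x] by (simp add: H_def inner_add_left field_simps flip: scaleR_left_distrib)
    then show "blinfun_apply (id_blinfun - T (H ?x)) \<circ> blinfun_apply (id_blinfun + T (G ?x)) = id"
      by (auto simp: fun_eq_iff plus_blinfun.rep_eq minus_blinfun.rep_eq T_apply)
  qed (rule blinfun.bounded_linear_right)
  \<comment> \<open>Bootstrapping: the derivative of \<open>inv S\<close> is a C^1 function of
    \<open>inv S\<close> itself, so continuity of \<open>inv S\<close> gives C^1, and C^1 in turn
    gives C^2.\<close>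
  have "C1_map (inv S)"
    unfolding C1_map_def
  proof (intro exI conjI allI)
    show "(inv S has_derivative blinfun_apply (id_blinfun - T (H (inv S y)))) (at y)" for y
      by (rule der_inv)
    have "continuous_on UNIV (inv S)"
      using cont by (simp add: continuous_on_eq_continuous_at)
    then have "continuous_on UNIV (\<lambda>y. T (H (inv S y)))"
      by (rule continuous_on_compose2[OF C1_map_continuous_on[OF T_C1[OF H]]]) auto
    then show "continuous_on UNIV (\<lambda>y. id_blinfun - T (H (inv S y)))"
      by (intro continuous_intros)
  qed
  then have "C1_map (\<lambda>y. id_blinfun + (- T (H (inv S y))))"
    by (intro C1_map_add C1_map_const C1_map_linear_compose[OF bounded_linear_minus[OF bounded_linear_ident]]
        C1_map_compose[OF T_C1[OF H]])
  then have "C2_map (inv S)"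
    unfolding C2_map_def using der_inv by (auto intro!: exI[of _ "\<lambda>y. id_blinfun - T (H (inv S y))"])
  with bij C2 show ?thesis
    by (simp add: Diff2_def S_def)
qed

lemma det_jacobian_shear:
  fixes g :: "real^'n \<Rightarrow> real"
  assumes "GDERIV g x :> D"
  shows "det (jacobian (\<lambda>x. x + g x *\<^sub>R axis k 1) (at x)) = 1 + D $ k"
proof -
  have "((\<lambda>x. x + g x *\<^sub>R axis k 1) has_derivative (\<lambda>h. h + (h \<bullet> D) *\<^sub>R axis k 1)) (at x)"
    using assms unfolding gderiv_def by (auto intro!: derivative_eq_intros)
  then have "jacobian (\<lambda>x. x + g x *\<^sub>R axis k 1) (at x) =
    matrix (\<lambda>h. h + (h \<bullet> D) *\<^sub>R axis k 1)"
    by (rule jacobian_eq_matrix)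
  \<comment> \<open>The matrix is the identity with row \<open>k\<close> replaced by the combination
    of its rows with coefficients \<open>D + axis k 1\<close>; Cramer's lemma then reads off the
    determinant.\<close>
  also have "\<dots> = (\<chi> i. if i = k then sum (\<lambda>i. (D + axis k 1)$i *s row i (mat 1)) UNIV
      else row i (mat 1))"
    by (auto simp: matrix_def vec_eq_iff row_def mat_def axis_def inner_axis_axis inner_vec_def sum.distrib
        if_distrib[of "\<lambda>x. _ * x"] if_distrib[of "\<lambda>x. x * _"] cong: if_cong)
  also have "det \<dots> = (D + axis k 1) $ k * det (mat 1 :: real^'n^'n)"
    by (rule cramer_lemma_transpose)
  finally show ?thesis by simp
qed

section \<open>Integrals of difference quotients\<close>

text \<open>The derivative is bounded on the compact ball, and the ball is convex, so the mean value
  inequality applies.\<close>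

lemma C1_map_lipschitz_on_ball:
  fixes f :: "'a::euclidean_space \<Rightarrow> 'b::real_normed_vector"
  assumes "C1_map f"
  obtains L where "0 \<le> L"
    and "\<And>x y. x \<in> cball c r \<Longrightarrow> y \<in> cball c r \<Longrightarrow> norm (f x - f y) \<le> L * norm (x - y)"
proof -
  obtain f' where f': "\<And>x. (f has_derivative blinfun_apply (f' x)) (at x)" "continuous_on UNIV f'"
    using assms unfolding C1_map_def by blast
  have "bounded (f' ` cball c r)"
    by (intro compact_imp_bounded compact_continuous_image continuous_on_subset[OF f'(2)]) auto
  then obtain L where L: "\<And>x. x \<in> cball c r \<Longrightarrow> norm (f' x) \<le> L"
    unfolding bounded_iff by blast
  have "norm (f x - f y) \<le> max 0 L * norm (x - y)" if "x \<in> cball c r" "y \<in> cball c r" for x y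
  proof (rule differentiable_bound[OF convex_cball, where f' = "\<lambda>x. blinfun_apply (f' x)"])
    show "onorm (blinfun_apply (f' x)) \<le> max 0 L" if "x \<in> cball c r" for x
      using L[OF that] by (simp add: norm_blinfun.rep_eq)
  qed (use that f'(1) in \<open>auto intro: has_derivative_at_withinI\<close>)
  then show thesis
    by (intro that[of "max 0 L"]) auto
qed

lemma tendsto_difference_quotient:
  fixes f :: "'a::real_normed_vector \<Rightarrow> 'b::real_normed_vector"
  assumes f: "(f has_derivative f') (at x)"
    and t: "t \<longlonglongrightarrow> 0" "\<And>n. t n \<noteq> (0::real)"
  shows "(\<lambda>n. (f (x + t n *\<^sub>R v) - f x) /\<^sub>R t n) \<longlonglongrightarrow> f' v"
proof -
  have "((\<lambda>s. f (x + s *\<^sub>R v)) has_derivative (\<lambda>s. f' (s *\<^sub>R v))) (at 0)"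
    by (rule has_derivative_compose[of "\<lambda>s. x + s *\<^sub>R v" "\<lambda>s. s *\<^sub>R v" _ _ f f'])
      (use f in \<open>auto intro!: derivative_eq_intros\<close>)
  then have "((\<lambda>s. norm (f (x + (0 + s) *\<^sub>R v) - f (x + 0 *\<^sub>R v) - f' (s *\<^sub>R v)) / norm s) \<longlongrightarrow> 0) (at 0)"
    by (simp only: has_derivative_at)
  then have "((\<lambda>s. norm (f (x + s *\<^sub>R v) - f x - s *\<^sub>R f' v) / norm s) \<longlongrightarrow> 0) (at 0)"
    by (simp only: linear_scale[OF has_derivative_linear[OF f]] add_0 scaleR_zero_left add_0_right)
  moreover have "norm (f (x + s *\<^sub>R v) - f x - s *\<^sub>R f' v) / norm s
      = norm ((f (x + s *\<^sub>R v) - f x) /\<^sub>R s - f' v)" if "s \<noteq> 0" for s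
  proof -
    have "(f (x + s *\<^sub>R v) - f x) /\<^sub>R s - f' v = (f (x + s *\<^sub>R v) - f x - s *\<^sub>R f' v) /\<^sub>R s"
      using that by (simp add: scaleR_diff_right)
    then show ?thesis by (simp add: divide_inverse_commute)
  qed
  ultimately have "((\<lambda>s. norm ((f (x + s *\<^sub>R v) - f x) /\<^sub>R s - f' v)) \<longlongrightarrow> 0) (at 0)"
    by (force intro: Lim_transform_eventually simp: eventually_at_filter)
  then have "((\<lambda>s. (f (x + s *\<^sub>R v) - f x) /\<^sub>R s) \<longlongrightarrow> f' v) (at 0)"
    by (simp only: tendsto_norm_zero_iff LIM_zero_iff)
  then show ?thesis
    using t by (auto simp: tendsto_at_iff_sequentially comp_def)
qed

lemma integrable_bounded_support:
  fixes f :: "'a::euclidean_space \<Rightarrow> real"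
  assumes "f \<in> borel_measurable borel" "\<And>x. \<bar>f x\<bar> \<le> K" "\<And>x. x \<notin> cball c r \<Longrightarrow> f x = 0"
  shows "integrable lborel f"
proof (rule Bochner_Integration.integrable_bound)
  show "integrable lborel (\<lambda>x. indicator (cball c r) x * K :: real)"
    using emeasure_lborel_cball_finite[of c r] by (intro integrable_mult_left integrable_real_indicator) auto
  show "AE x in lborel. norm (f x) \<le> norm (indicator (cball c r) x * K)"
    using order_trans[OF assms(2) abs_ge_self] assms(3) by (intro AE_I2) (auto simp: indicator_def)
qed (use assms(1) in simp)

lemma continuous_bounded_support:
  fixes f :: "'a::euclidean_space \<Rightarrow> 'b::real_normed_vector"
  assumes "continuous_on UNIV f" "\<And>x. x \<notin> cball c r \<Longrightarrow> f x = 0"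
  obtains K where "\<And>x. norm (f x) \<le> K"
proof -
  have "bounded (f ` cball c r)"
    by (intro compact_imp_bounded compact_continuous_image continuous_on_subset[OF assms(1)]) auto
  then obtain K where "\<And>x. x \<in> cball c r \<Longrightarrow> norm (f x) \<le> K"
    unfolding bounded_iff by blast
  then have "norm (f x) \<le> max 0 K" for x
    using assms(2)[of x] by (cases "x \<in> cball c r") (auto simp: le_max_iff_disj)
  then show thesis by (rule that)
qed

lemma integrable_continuous_support:
  fixes f :: "'a::euclidean_space \<Rightarrow> real"
  assumes "continuous_on UNIV f" "\<And>x. x \<notin> cball c r \<Longrightarrow> f x = 0"
  shows "integrable lborel f"
proof -
  obtain K where "\<And>x. norm (f x) \<le> K"
    using continuous_bounded_support[OF assms] by blast
  then show ?thesis
    using assms by (intro integrable_bounded_support[of f K c r] borel_measurable_continuous_onI) auto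
qed

text \<open>Dominated convergence: outside the ball carrying \<open>g\<close> the quotient is 0, and
  inside it is bounded through a local Lipschitz constant of \<open>f\<close>. Requiring
  \<open>g\<close> to be merely measurable allows an indicator in its place.\<close>

lemma LIMSEQ_integral_difference_quotient:
  fixes f :: "'a::euclidean_space \<Rightarrow> 'b::euclidean_space"
  assumes f: "C1_map f" "\<And>x. (f has_derivative f' x) (at x)"
    and \<rho>: "continuous_on UNIV \<rho>"
    and g: "g \<in> borel_measurable borel" "\<And>x. \<bar>g x\<bar> \<le> M" "\<And>x. x \<notin> cball c r \<Longrightarrow> g x = 0"
    and t: "t \<longlonglongrightarrow> 0" "\<And>n. t n \<noteq> 0" "\<And>n. \<bar>t n\<bar> \<le> 1"
  shows "(\<lambda>n. \<integral>x. \<rho> x \<bullet> ((f (x + (t n * g x) *\<^sub>R a) - f x) /\<^sub>R t n) \<partial>lborel)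
    \<longlonglongrightarrow> (\<integral>x. \<rho> x \<bullet> f' x (g x *\<^sub>R a) \<partial>lborel)"
proof -
  have M: "0 \<le> M" using g(2)[of undefined] by linarith
  \<comment> \<open>Since \<open>t n\<close> is at most 1 in absolute value, enlarging the radius by
    \<open>M * norm a\<close> captures every displaced point.\<close>
  obtain L where L: "0 \<le> L" "\<And>x y. x \<in> cball c (r + M * norm a) \<Longrightarrow> y \<in> cball c (r + M * norm a) \<Longrightarrow>
      norm (f x - f y) \<le> L * norm (x - y)"
    using C1_map_lipschitz_on_ball[OF f(1)] by blast
  have "bounded (\<rho> ` cball c r)"
    by (intro compact_imp_bounded compact_continuous_image continuous_on_subset[OF \<rho>]) auto
  then obtain K where K: "\<And>x. x \<in> cball c r \<Longrightarrow> norm (\<rho> x) \<le> K"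
    unfolding bounded_iff by blast
  have [measurable]: "\<rho> \<in> borel_measurable borel" "f \<in> borel_measurable borel" "g \<in> borel_measurable borel"
    using \<rho> C1_map_continuous_on[OF f(1)] g(1) by (auto intro: borel_measurable_continuous_onI)
  have lim: "(\<lambda>n. \<rho> x \<bullet> ((f (x + (t n * g x) *\<^sub>R a) - f x) /\<^sub>R t n)) \<longlonglongrightarrow> \<rho> x \<bullet> f' x (g x *\<^sub>R a)" for x
    using tendsto_difference_quotient[OF f(2) t(1,2), of x "g x *\<^sub>R a"]
    by (intro tendsto_intros) (simp add: scaleR_scaleR)
  show ?thesis
  proof (rule integral_dominated_convergence)
    show "(\<lambda>x. \<rho> x \<bullet> f' x (g x *\<^sub>R a)) \<in> borel_measurable lborel"
      by (rule borel_measurable_LIMSEQ_real[OF lim]) simp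
    show "(\<lambda>x. \<rho> x \<bullet> ((f (x + (t n * g x) *\<^sub>R a) - f x) /\<^sub>R t n)) \<in> borel_measurable lborel" for n
      by simp
    show "integrable lborel (\<lambda>x. indicator (cball c r) x * (K * (L * (M * norm a))) :: real)"
      using emeasure_lborel_cball_finite[of c r]
      by (intro integrable_mult_left integrable_real_indicator) auto
    show "AE x in lborel. norm (\<rho> x \<bullet> ((f (x + (t n * g x) *\<^sub>R a) - f x) /\<^sub>R t n))
        \<le> indicator (cball c r) x * (K * (L * (M * norm a)))" for n
    proof (rule AE_I2)
      fix x
      show "norm (\<rho> x \<bullet> ((f (x + (t n * g x) *\<^sub>R a) - f x) /\<^sub>R t n))
        \<le> indicator (cball c r) x * (K * (L * (M * norm a)))"
      proof (cases "x \<in> cball c r")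
        case True
        let ?s = "t n * g x"
        have s: "\<bar>?s\<bar> \<le> \<bar>t n\<bar> * M"
          using g(2)[of x] by (simp add: abs_mult mult_left_mono)
        also have "\<dots> \<le> 1 * M"
          using t(3) M by (intro mult_right_mono) auto
        finally have "norm (?s *\<^sub>R a) \<le> M * norm a"
          by (simp add: mult_right_mono)
        moreover have "dist c (x + ?s *\<^sub>R a) \<le> dist c x + norm (?s *\<^sub>R a)"
          using dist_triangle[of c "x + ?s *\<^sub>R a" x] by (simp add: dist_norm)
        ultimately have "x + ?s *\<^sub>R a \<in> cball c (r + M * norm a)"
          using True by simp
        moreover have "x \<in> cball c (r + M * norm a)"
          using True M by (auto intro: add_increasing2)
        ultimately have "norm (f (x + ?s *\<^sub>R a) - f x) \<le> L * (\<bar>?s\<bar> * norm a)"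
          using L(2)[of "x + ?s *\<^sub>R a" x] by simp
        also have "\<dots> \<le> L * ((\<bar>t n\<bar> * M) * norm a)"
          using s L(1) by (intro mult_left_mono mult_right_mono) auto
        finally have "norm ((f (x + ?s *\<^sub>R a) - f x) /\<^sub>R t n) \<le> L * (M * norm a)"
          using t(2)[of n] by (simp add: inverse_eq_divide pos_divide_le_eq mult_ac)
        then have "norm (\<rho> x) * norm ((f (x + ?s *\<^sub>R a) - f x) /\<^sub>R t n) \<le> K * (L * (M * norm a))"
          using K[OF True] by (intro mult_mono) (auto intro: order_trans[OF norm_ge_zero])
        then show ?thesis
          using True Cauchy_Schwarz_ineq2[of "\<rho> x" "(f (x + ?s *\<^sub>R a) - f x) /\<^sub>R t n"] by simp
      qed (use g(3) in simp)
    qed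
  qed (use lim in simp)
qed

text \<open>By translation invariance of Lebesgue measure every difference quotient in direction
  \<open>a\<close> integrates to 0, and this passes to the limit. Applied to a product, it is
  integration by parts.\<close>

lemma integral_derivative_compact_support:
  fixes f :: "'a::euclidean_space \<Rightarrow> real"
  assumes f: "C1_map f" "\<And>x. (f has_derivative f' x) (at x)"
    and supp: "\<And>x. x \<notin> cball c r \<Longrightarrow> f x = 0"
  shows "(\<integral>x. f' x a \<partial>lborel) = 0"
proof -
  \<comment> \<open>With this radius, \<open>f\<close> vanishes at \<open>x\<close> and at
    \<open>x + s *\<^sub>R a\<close> for \<open>s\<close> in [0, 1] whenever \<open>x\<close> lies
    outside the larger ball. Cutting the displacement off by the indicator \<open>g\<close>
    therefore leaves the quotient unchanged.\<close>
  define R where "R = r + norm a"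
  define g :: "'a \<Rightarrow> real" where "g = indicator (cball c R)"
  define t :: "nat \<Rightarrow> real" where "t n = 1 / real (Suc n)" for n
  have t: "0 < t n" "t n \<le> 1" for n
    by (auto simp: t_def)
  have int: "integrable lborel f"
    by (rule integrable_continuous_support[OF C1_map_continuous_on[OF f(1)] supp])
  have out: "f (x + s *\<^sub>R a) = 0" if "x \<notin> cball c R" "0 \<le> s" "s \<le> 1" for x s
  proof (rule supp)
    have "dist c x \<le> dist c (x + s *\<^sub>R a) + norm (s *\<^sub>R a)"
      using dist_triangle[of c x "x + s *\<^sub>R a"] by (simp add: dist_norm)
    moreover have "norm (s *\<^sub>R a) \<le> norm a"
      using that by (simp add: mult_left_le_one_le)
    ultimately show "x + s *\<^sub>R a \<notin> cball c r"
      using that(1) by (auto simp: R_def)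
  qed
  have zero: "(\<integral>x. 1 \<bullet> ((f (x + (t n * g x) *\<^sub>R a) - f x) /\<^sub>R t n) \<partial>lborel) = 0" for n
  proof -
    have "1 \<bullet> ((f (x + (t n * g x) *\<^sub>R a) - f x) /\<^sub>R t n) = (f (t n *\<^sub>R a + x) - f x) / t n" for x
      using out[of x 0] out[of x "t n"] t[of n]
      by (auto simp: g_def indicator_def add.commute divide_inverse_commute)
    moreover have "(\<integral>x. f (t n *\<^sub>R a + x) \<partial>lborel) = (\<integral>x. f x \<partial>lborel)"
    proof -
      have "(\<integral>x. f x \<partial>lborel) = (\<integral>x. f x \<partial>distr lborel borel ((+) (t n *\<^sub>R a)))"
        by (simp add: lborel_distr_plus)
      also have "\<dots> = (\<integral>x. f (t n *\<^sub>R a + x) \<partial>lborel)"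
        using int by (intro integral_distr) auto
      finally show ?thesis by simp
    qed
    moreover have "integrable lborel (\<lambda>x. f (t n *\<^sub>R a + x))"
    proof -
      have "integrable (distr lborel borel ((+) (t n *\<^sub>R a))) f"
        using int by (simp add: lborel_distr_plus)
      then show ?thesis
        by (rule integrable_distr[rotated]) simp
    qed
    ultimately show ?thesis
      using int by simp
  qed
  have "(\<lambda>n. \<integral>x. 1 \<bullet> ((f (x + (t n * g x) *\<^sub>R a) - f x) /\<^sub>R t n) \<partial>lborel)
      \<longlonglongrightarrow> (\<integral>x. 1 \<bullet> f' x (g x *\<^sub>R a) \<partial>lborel)"
  proof (rule LIMSEQ_integral_difference_quotient[where M = 1 and c = c and r = R])
    show "t \<longlonglongrightarrow> 0"
      unfolding t_def by real_asymp
  qed (use f t in \<open>auto simp: g_def indicator_def abs_of_pos less_imp_neq[symmetric]\<close>)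
  then have "(\<integral>x. 1 \<bullet> f' x (g x *\<^sub>R a) \<partial>lborel) = 0"
    unfolding zero LIMSEQ_const_iff by simp
  \<comment> \<open>Removes the cutoff: outside the larger ball all quotients along
    \<open>t n\<close> are 0, hence so is their limit \<open>f' x a\<close>.\<close>
  moreover have "f' x (g x *\<^sub>R a) = f' x a" for x
  proof (cases "x \<in> cball c R")
    case False
    have lim: "(\<lambda>n. (f (x + t n *\<^sub>R a) - f x) /\<^sub>R t n) \<longlonglongrightarrow> f' x a"
    proof (rule tendsto_difference_quotient[OF f(2)])
      show "t \<longlonglongrightarrow> 0" unfolding t_def by real_asymp
    qed (use t(1) in \<open>metis less_irrefl\<close>)
    have zero: "(f (x + t n *\<^sub>R a) - f x) /\<^sub>R t n = 0" for n
      using out[OF False, of 0] out[OF False, of "t n"] t[of n] by simp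
    have "f' x a = 0"
      using lim unfolding zero LIMSEQ_const_iff by simp
    then show ?thesis
      using False linear_0[OF has_derivative_linear[OF f(2)]] by (simp add: g_def)
  qed (simp add: g_def)
  ultimately show ?thesis by simp
qed

section \<open>The Gaussian noise\<close>

text \<open>Tonelli's product formula over \<open>Basis\<close>, reindexed along the bijection
  \<open>i \<mapsto> axis i 1\<close>.\<close>

lemma nn_integral_lborel_prod_vec:
  fixes f :: "'n::finite \<Rightarrow> real \<Rightarrow> ennreal"
  assumes "\<And>i. f i \<in> borel_measurable borel"
  shows "(\<integral>\<^sup>+ (z :: real^'n). (\<Prod>i\<in>UNIV. f i (z $ i)) \<partial>lborel) = (\<Prod>i\<in>UNIV. (\<integral>\<^sup>+ s. f i s \<partial>lborel))"
proof -
  let ?ax = "\<lambda>i :: 'n. axis i (1::real)"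
  define F where "F b = f (the_inv ?ax b)" for b
  have inj: "inj ?ax"
    by (auto simp: inj_on_def axis_eq_axis)
  have F: "F (?ax i) = f i" for i
    by (simp add: F_def the_inv_f_f[OF inj])
  have Basis: "(Basis :: (real^'n) set) = range ?ax"
    by (auto simp: Basis_vec_def)
  have "(\<integral>\<^sup>+ (z :: real^'n). (\<Prod>b\<in>Basis. F b (z \<bullet> b)) \<partial>lborel) = (\<Prod>b\<in>Basis. (\<integral>\<^sup>+ s. F b s \<partial>lborel))"
    by (rule nn_integral_lborel_prod) (auto simp: F_def assms)
  then show ?thesis
    by (simp add: Basis prod.reindex[OF inj] F inner_axis)
qed

lemma borel_measurable_isotropic_density [measurable]:
  "(\<lambda>z :: real^'n. \<Prod>i\<in>UNIV. normal_density 0 \<delta> (z $ i)) \<in> borel_measurable borel"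
  by measurable

lemma prob_space_isotropic_gaussian:
  assumes "\<delta> > 0"
  shows "prob_space (isotropic_gaussian \<delta> :: (real^'n) measure)"
proof
  have "(\<integral>\<^sup>+ s. ennreal (normal_density 0 \<delta> s) \<partial>lborel) = 1"
    using prob_space.emeasure_space_1[OF prob_space_normal_density[OF assms, of 0]]
    by (simp add: emeasure_density)
  then have "(\<integral>\<^sup>+ (z :: real^'n). (\<Prod>i\<in>UNIV. ennreal (normal_density 0 \<delta> (z $ i))) \<partial>lborel) = 1"
    by (subst nn_integral_lborel_prod_vec) auto
  then show "emeasure (isotropic_gaussian \<delta>) (space (isotropic_gaussian \<delta> :: (real^'n) measure)) = 1"
    by (simp add: isotropic_gaussian_def emeasure_density prod_ennreal)
qed

lemma integrable_isotropic_gaussian_norm: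
  assumes "\<delta> > 0"
  shows "integrable (isotropic_gaussian \<delta> :: (real^'n) measure) norm"
proof -
  have comp: "integrable (isotropic_gaussian \<delta> :: (real^'n) measure) (\<lambda>z. \<bar>z $ k\<bar>)" for k
  proof (rule integrableI_bounded)
    \<comment> \<open>The integrand factorizes: coordinate \<open>k\<close> contributes a first
      absolute moment, every other coordinate the total mass of a normal density.\<close>
    define f where "f i = (\<lambda>s. ennreal (normal_density 0 \<delta> s * (if i = k then \<bar>s\<bar> else 1)))" for i :: 'n
    have "(\<integral>\<^sup>+ s. f i s \<partial>lborel) < \<infinity>" for i
    proof -
      have "integrable lborel (\<lambda>s. normal_density 0 \<delta> s * (if i = k then \<bar>s\<bar> else 1))"
        using integrable_normal_moment_abs[OF assms, of 0 1] integrable_normal_moment_abs[OF assms, of 0 0]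
        by (cases "i = k") simp_all
      then show ?thesis
        unfolding f_def by (subst nn_integral_eq_integral) auto
    qed
    then have "(\<Prod>i\<in>UNIV. (\<integral>\<^sup>+ s. f i s \<partial>lborel)) < \<infinity>"
      by (simp add: less_top[symmetric] ennreal_prod_eq_top)
    also have "(\<Prod>i\<in>UNIV. (\<integral>\<^sup>+ s. f i s \<partial>lborel)) = (\<integral>\<^sup>+ (z :: real^'n). (\<Prod>i\<in>UNIV. f i (z $ i)) \<partial>lborel)"
      by (subst nn_integral_lborel_prod_vec) (auto simp: f_def)
    also have "\<dots> = (\<integral>\<^sup>+ z. ennreal (norm \<bar>z $ k\<bar>) \<partial>(isotropic_gaussian \<delta> :: (real^'n) measure))"
      by (simp add: isotropic_gaussian_def nn_integral_density f_def prod_ennreal prod.distrib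
          prod_nonneg flip: ennreal_mult')
    finally show "(\<integral>\<^sup>+ z. ennreal (norm \<bar>z $ k\<bar>) \<partial>(isotropic_gaussian \<delta> :: (real^'n) measure)) < \<infinity>" .
  qed (simp add: isotropic_gaussian_def)
  show ?thesis
  proof (rule Bochner_Integration.integrable_bound)
    show "integrable (isotropic_gaussian \<delta> :: (real^'n) measure) (\<lambda>z. \<Sum>k\<in>UNIV. \<bar>z $ k\<bar>)"
      by (intro Bochner_Integration.integrable_sum comp)
    show "AE (z :: real^'n) in isotropic_gaussian \<delta>. norm (norm z) \<le> norm (\<Sum>k\<in>UNIV. \<bar>z $ k\<bar>)"
      using norm_le_l1_cart by (intro AE_I2) (auto simp: abs_of_nonneg sum_nonneg)
  qed (simp add: isotropic_gaussian_def)
qed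

text \<open>The density is even and the integrand odd, so the reflection
  \<open>z \<mapsto> - z\<close>, which preserves Lebesgue measure, equates the integral with its
  negative.\<close>

lemma integral_isotropic_gaussian_inner:
  "(\<integral>z. z \<bullet> v \<partial>(isotropic_gaussian \<delta> :: (real^'n) measure)) = 0"
proof -
  define \<rho> where "\<rho> z = (\<Prod>i\<in>UNIV. normal_density 0 \<delta> (z $ i))" for z :: "real^'n"
  have [measurable]: "\<rho> \<in> borel_measurable borel"
    unfolding \<rho>_def by measurable
  have \<rho>: "\<rho> z \<ge> 0" "\<rho> (- z) = \<rho> z" for z
    by (auto simp: \<rho>_def prod_nonneg normal_density_def)
  have G: "(\<integral>z. z \<bullet> v \<partial>(isotropic_gaussian \<delta> :: (real^'n) measure)) = (\<integral>z. \<rho> z * (z \<bullet> v) \<partial>lborel)"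
    unfolding isotropic_gaussian_def \<rho>_def[symmetric] using \<rho> by (subst integral_density) auto
  have refl: "lborel = distr lborel borel (\<lambda>z :: real^'n. - z)"
    using lborel_affine[of "-1" "0 :: real^'n"] by (simp add: density_1)
  have "(\<integral>z. \<rho> z * (z \<bullet> v) \<partial>lborel) = (\<integral>z. \<rho> z * (z \<bullet> v) \<partial>distr lborel borel (\<lambda>z :: real^'n. - z))"
    by (simp flip: refl)
  also have "\<dots> = (\<integral>z. \<rho> (- z) * (- z \<bullet> v) \<partial>lborel)"
    by (intro integral_distr) auto
  finally show ?thesis
    unfolding G by (simp add: \<rho>)
qed

text \<open>Under the joint law \<open>y - A x\<close> is the centred noise, independent of
  \<open>x\<close>, so Fubini removes the term linear in it. This is exactly the shape of the change
  of the loss integrand under a shear.\<close>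

lemma joint_law_integral:
  fixes p :: "real^'n \<Rightarrow> real"
  assumes A: "linear A" and \<delta>: "\<delta> > 0" and p: "continuous_on UNIV p" "\<And>x. p x \<ge> 0"
    and P: "prob_space (density lborel (\<lambda>x. ennreal (p x)))"
    and c: "c \<in> borel_measurable borel" "\<And>x. \<bar>c x\<bar> \<le> K"
    and u: "u \<in> borel_measurable borel" "\<And>x. norm (u x) \<le> M"
  shows "integrable (joint_law A \<delta> p) (\<lambda>(x, y). c x + (y - A x) \<bullet> u x)"
    and "(\<integral>(x, y). c x + (y - A x) \<bullet> u x \<partial>joint_law A \<delta> p) = (\<integral>x. p x * c x \<partial>lborel)"
proof -
  define PX where "PX = density lborel (\<lambda>x. ennreal (p x))"
  define G where "G = (isotropic_gaussian \<delta> :: (real^'n) measure)"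
  interpret PX: prob_space PX using P by (simp add: PX_def)
  interpret G: prob_space G using prob_space_isotropic_gaussian[OF \<delta>] by (simp add: G_def)
  interpret pair_sigma_finite PX G ..
  have sets [measurable_cong]: "sets PX = sets borel" "sets G = sets borel"
    by (auto simp: PX_def G_def isotropic_gaussian_def)
  have [measurable]: "c \<in> borel_measurable borel" "u \<in> borel_measurable borel" by fact+
  have [measurable]: "p \<in> borel_measurable borel" "A \<in> borel_measurable borel"
    using p(1) linear_continuous_on[of A UNIV] A
    by (auto intro!: borel_measurable_continuous_onI simp: linear_conv_bounded_linear)
  have T: "(\<lambda>(x, \<eta>). (x, A x + \<eta>)) \<in> PX \<Otimes>\<^sub>M G \<rightarrow>\<^sub>M (borel :: ((real^'n) \<times> (real^'n)) measure)"
    unfolding borel_prod[symmetric] by measurable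
  have F: "(\<lambda>(x, y). c x + (y - A x) \<bullet> u x) \<in> borel_measurable (borel :: ((real^'n) \<times> (real^'n)) measure)"
    unfolding borel_prod[symmetric] by measurable
  define f where "f = (\<lambda>(x, \<eta>). c x + \<eta> \<bullet> u x)"
  have f [measurable]: "f \<in> borel_measurable (PX \<Otimes>\<^sub>M G)"
    unfolding f_def by measurable
  have f_eq: "(\<lambda>z. case (case z of (x, \<eta>) \<Rightarrow> (x, A x + \<eta>)) of (x, y) \<Rightarrow> c x + (y - A x) \<bullet> u x) = f"
    by (auto simp: f_def fun_eq_iff)
  have norm_int: "integrable G norm"
    unfolding G_def by (rule integrable_isotropic_gaussian_norm[OF \<delta>])
  have ident_int: "integrable G (\<lambda>\<eta>. \<eta>)"
    using norm_int by (subst integrable_norm_iff[symmetric]) auto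
  \<comment> \<open>A majorant free of \<open>x\<close> and integrable in the noise; as the prior is
    a probability measure, this suffices for joint integrability.\<close>
  have bound: "norm (f (x, \<eta>)) \<le> K + norm \<eta> * M" for x \<eta>
  proof -
    have "\<bar>\<eta> \<bullet> u x\<bar> \<le> norm \<eta> * M"
      using Cauchy_Schwarz_ineq2[of \<eta> "u x"] mult_left_mono[OF u(2)[of x] norm_ge_zero[of \<eta>]] by linarith
    then show ?thesis
      using c(2)[of x] by (simp add: f_def)
  qed
  have inner: "integrable G (\<lambda>\<eta>. f (x, \<eta>))" for x
    using ident_int by (auto simp: f_def)
  have int: "integrable (PX \<Otimes>\<^sub>M G) f"
  proof (rule Fubini_integrable)
    have "(\<integral>\<eta>. norm (f (x, \<eta>)) \<partial>G) \<le> (\<integral>\<eta>. K + norm \<eta> * M \<partial>G)" for x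
      using norm_int inner by (intro integral_mono bound) auto
    then show "integrable PX (\<lambda>x. \<integral>\<eta>. norm (f (x, \<eta>)) \<partial>G)"
      by (intro PX.integrable_const_bound[where B = "\<integral>\<eta>. K + norm \<eta> * M \<partial>G"])
        (auto intro!: AE_I2 simp: abs_of_nonneg)
  qed (auto simp: inner)
  then show "integrable (joint_law A \<delta> p) (\<lambda>(x, y). c x + (y - A x) \<bullet> u x)"
    unfolding joint_law_def PX_def[symmetric] G_def[symmetric]
    by (subst integrable_distr_eq[OF T F]) (simp only: f_eq)
  have "(\<integral>(x, y). c x + (y - A x) \<bullet> u x \<partial>joint_law A \<delta> p) = integral\<^sup>L (PX \<Otimes>\<^sub>M G) f"
    unfolding joint_law_def PX_def[symmetric] G_def[symmetric]
    by (subst integral_distr[OF T F]) (simp only: f_eq)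
  also have "\<dots> = (\<integral>x. (\<integral>\<eta>. f (x, \<eta>) \<partial>G) \<partial>PX)"
    by (rule integral_fst'[OF int, symmetric])
  also have "\<dots> = (\<integral>x. c x \<partial>PX)"
  proof (rule Bochner_Integration.integral_cong[OF refl])
    show "(\<integral>\<eta>. f (x, \<eta>) \<partial>G) = c x" for x
      using ident_int integral_isotropic_gaussian_inner[where v = "u x" and \<delta> = \<delta>]
      by (simp add: f_def G_def[symmetric] G.prob_space del: integral_inner_left)
  qed
  also have "\<dots> = (\<integral>x. p x * c x \<partial>lborel)"
    unfolding PX_def using p(2) by (subst integral_density) auto
  finally show "(\<integral>(x, y). c x + (y - A x) \<bullet> u x \<partial>joint_law A \<delta> p) = (\<integral>x. p x * c x \<partial>lborel)" .
qed

section \<open>Bump functions\<close>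

text \<open>Only the kink at 0 is delicate: with exponent at least 2 the quotient there is bounded
  by a positive power of \<open>\<bar>h\<bar>\<close>.\<close>

lemma DERIV_max_0_power:
  "((\<lambda>s::real. max 0 s ^ Suc (Suc n)) has_real_derivative real (Suc (Suc n)) * max 0 s ^ Suc n) (at s)"
proof -
  consider "s < 0" | "s = 0" | "s > 0" by linarith
  then show ?thesis
  proof cases
    case 1
    have "((\<lambda>s::real. 0) has_real_derivative 0) (at s)" by simp
    then have "((\<lambda>s::real. max 0 s ^ Suc (Suc n)) has_real_derivative 0) (at s)"
      by (rule has_field_derivative_transform_within_open[of _ _ _ "{..<0}"]) (use 1 in auto)
    then show ?thesis using 1 by simp
  next
    case 2
    have bound: "\<bar>max 0 h ^ Suc (Suc n) / h\<bar> \<le> \<bar>h\<bar> ^ Suc n" for h :: real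
    proof (cases "h > 0")
      case False
      then have "max 0 h = 0" by simp
      then show ?thesis 
        by (simp only: power_0_Suc div_0 abs_zero) (intro zero_le_power abs_ge_zero)
    qed (simp add: max_def)
    have lim: "((\<lambda>h::real. \<bar>h\<bar> ^ Suc n) \<longlongrightarrow> 0) (at 0)"
      using tendsto_power[OF tendsto_rabs[OF tendsto_ident_at[of "0::real" UNIV]], of "Suc n"] by (simp del: power_Suc add: power_0_Suc)
    have "((\<lambda>h::real. max 0 h ^ Suc (Suc n) / h) \<longlongrightarrow> 0) (at 0)"
      by (rule Lim_null_comparison[OF always_eventually lim]) (simp only: real_norm_def bound simp_thms)
    then show ?thesis
      using 2 by (simp add: DERIV_def)
  next
    case 3
    have "((\<lambda>s::real. s ^ Suc (Suc n)) has_real_derivative real (Suc (Suc n)) * s ^ Suc n) (at s)"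
      using DERIV_pow[of "Suc (Suc n)" s] by simp
    then have "((\<lambda>s::real. max 0 s ^ Suc (Suc n)) has_real_derivative real (Suc (Suc n)) * s ^ Suc n) (at s)"
      by (rule has_field_derivative_transform_within_open[of _ _ _ "{0<..}"]) (use 3 in auto)
    then show ?thesis using 3 by simp
  qed
qed

text \<open>The cube of the positive part is smooth enough for the gradient, which carries its
  square, to be C^1, as \<open>shear_Diff2\<close> demands.\<close>

definition bump :: "'a::euclidean_space \<Rightarrow> real \<Rightarrow> 'a \<Rightarrow> real" where
  "bump c r x = max 0 (r\<^sup>2 - (x - c) \<bullet> (x - c)) ^ 3"

definition bump_grad :: "'a::euclidean_space \<Rightarrow> real \<Rightarrow> 'a \<Rightarrow> 'a" where
  "bump_grad c r x = (- 6 * max 0 (r\<^sup>2 - (x - c) \<bullet> (x - c)) ^ 2) *\<^sub>R (x - c)"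

lemma bump_nonneg: "0 \<le> bump c r x"
  by (simp add: bump_def)

lemma bump_pos:
  assumes "x \<in> ball c r"
  shows "0 < bump c r x"
proof -
  have "(x - c) \<bullet> (x - c) < r\<^sup>2"
    using assms norm_lt_square[of "x - c" r] by (simp add: dist_norm norm_minus_commute)
  then show ?thesis
    by (simp add: bump_def)
qed

lemma bump_outside:
  assumes "r > 0" "x \<notin> cball c r"
  shows "bump c r x = 0" "bump_grad c r x = 0"
proof -
  have "max 0 (r\<^sup>2 - (x - c) \<bullet> (x - c)) = 0"
    using assms norm_lt_square[of "x - c" r] by (simp add: dist_norm norm_minus_commute)
  then show "bump c r x = 0" "bump_grad c r x = 0"
    by (simp_all only: bump_def bump_grad_def power_zero_numeral mult_zero_right scaleR_zero_left)
qed

lemma GDERIV_bump: "GDERIV (bump c r) x :> bump_grad c r x"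
proof -
  have "((\<lambda>x. r\<^sup>2 - (x - c) \<bullet> (x - c)) has_derivative (\<lambda>h. - 2 * (h \<bullet> (x - c)))) (at x)"
    by (auto intro!: derivative_eq_intros simp: inner_commute)
  moreover have "((\<lambda>s. max 0 s ^ 3) has_derivative (*) (3 * max 0 s ^ 2)) (at s)" for s :: real
    using DERIV_max_0_power[of 1 s] by (simp add: has_field_derivative_def numeral_eq_Suc)
  ultimately have "((\<lambda>x. max 0 (r\<^sup>2 - (x - c) \<bullet> (x - c)) ^ 3) has_derivative
      (\<lambda>h. 3 * max 0 (r\<^sup>2 - (x - c) \<bullet> (x - c)) ^ 2 * (- 2 * (h \<bullet> (x - c))))) (at x)"
    by (rule has_derivative_compose)
  then show ?thesis
    unfolding gderiv_def bump_def[abs_def] bump_grad_def by (simp add: mult_ac)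
qed

lemma C1_map_bump_grad: "C1_map (bump_grad c r)"
proof -
  have diff: "C1_map (\<lambda>x. x + - c)"
    by (intro C1_map_add C1_map_const C1_map_bounded_linear bounded_linear_ident)
  have "C1_map (\<lambda>x. r\<^sup>2 + - 1 * ((x + - c) \<bullet> (x + - c)))"
    by (intro C1_map_add C1_map_mult C1_map_const C1_map_bilinear[OF bounded_bilinear_inner] diff)
  then have "C1_map (\<lambda>x. max 0 (r\<^sup>2 + - 1 * ((x + - c) \<bullet> (x + - c))) ^ Suc (Suc 0))"
    by (rule C1_map_real_compose[where u' = "\<lambda>s. real (Suc (Suc 0)) * max 0 s ^ Suc 0", OF _ DERIV_max_0_power])
      (auto intro!: continuous_intros)
  then have "C1_map (\<lambda>x. (- 6 * max 0 (r\<^sup>2 + - 1 * ((x + - c) \<bullet> (x + - c))) ^ Suc (Suc 0)) *\<^sub>R (x + - c))"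
    by (intro C1_map_bilinear[OF bounded_bilinear_scaleR] C1_map_mult C1_map_const diff)
  then show ?thesis
    by (simp add: bump_grad_def[abs_def] numeral_eq_Suc)
qed

lemma C1_map_GDERIV:
  fixes g :: "'a::euclidean_space \<Rightarrow> real"
  assumes "\<And>x. GDERIV g x :> G x" "C1_map G"
  shows "C1_map g"
proof (rule C1_mapI)
  show "(g has_derivative (\<lambda>h. h \<bullet> G x)) (at x)" for x
    using assms(1) by (simp add: gderiv_def)
  show "continuous_on UNIV (\<lambda>x. h \<bullet> G x)" for h
    by (intro continuous_intros C1_map_continuous_on[OF assms(2)])
qed

lemmas C1_map_bump = C1_map_GDERIV[OF GDERIV_bump C1_map_bump_grad]

text \<open>If \<open>h c\<close> were nonzero, \<open>h\<close> would keep its sign on a small ball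
  around \<open>c\<close>. A bump there has a one-signed product with \<open>h\<close>, so a zero
  integral would make the ball a null set.\<close>

lemma fundamental_lemma_bump:
  fixes h :: "'a::euclidean_space \<Rightarrow> real"
  assumes h: "continuous_on UNIV h"
    and int: "\<And>r. r > 0 \<Longrightarrow> (\<integral>x. bump c r x * h x \<partial>lborel) = 0"
  shows "h c = 0"
proof (rule ccontr)
  assume nz: "h c \<noteq> 0"
  \<comment> \<open>Multiplying by the sign of \<open>h c\<close> reduces to the case of a positive
    value at \<open>c\<close>.\<close>
  define k where "k x = sgn (h c) * h x" for x
  have k: "continuous_on UNIV k" "k c > 0"
    using nz by (auto simp: k_def sgn_if intro!: continuous_intros h)
  have int_k: "(\<integral>x. bump c r x * k x \<partial>lborel) = 0" if "r > 0" for r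
  proof -
    have "(\<integral>x. bump c r x * k x \<partial>lborel) = (\<integral>x. sgn (h c) * (bump c r x * h x) \<partial>lborel)"
      by (simp add: k_def mult_ac)
    then show ?thesis
      using int[OF that] by simp
  qed
  have "open (k -` {0<..})"
    by (rule open_vimage[OF open_greaterThan k(1)])
  then obtain r where r: "r > 0" "cball c r \<subseteq> k -` {0<..}"
    using k(2) open_contains_cball by (metis greaterThan_iff vimageI)
  have nonneg: "0 \<le> bump c r x * k x" for x
    using r(2) bump_outside(1)[OF r(1)] bump_nonneg[of c r x]
    by (cases "x \<in> cball c r") (force intro: mult_nonneg_nonneg less_imp_le)+
  have "integrable lborel (\<lambda>x. bump c r x * k x)"
    using bump_outside(1)[OF r(1)]
    by (intro integrable_continuous_support[where c = c and r = r] continuous_intros k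
        C1_map_continuous_on[OF C1_map_bump]) auto
  then have "AE x in lborel. bump c r x * k x = 0"
    using int_k[OF r(1)] nonneg by (subst (asm) integral_nonneg_eq_0_iff_AE) auto
  then have "AE x in lborel. x \<notin> ball c r"
  proof eventually_elim
    case (elim x)
    show ?case
    proof
      assume x: "x \<in> ball c r"
      then have "k x > 0"
        using r(2) ball_subset_cball by blast
      then show False
        using elim bump_pos[OF x] by simp
    qed
  qed
  then have "ball c r \<in> null_sets lborel"
    by (simp add: AE_iff_null_sets)
  then have "negligible (ball c r)"
    by (simp add: negligible_iff_null_sets null_sets_completionI)
  then show False
    using open_not_negligible[of "ball c r"] r(1) by simp
qed

section \<open>The first variation\<close>

text \<open>The estimate of \<open>ln (1 + s) - s\<close> by \<open>2 * s\<^sup>2\<close> for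
  \<open>\<bar>s\<bar> \<le> 1 / 2\<close> bounds the error of the integrals by
  \<open>\<bar>t n\<bar> * C\<close>.\<close>

lemma LIMSEQ_integral_ln_quotient:
  fixes D \<rho> :: "'a::euclidean_space \<Rightarrow> real"
  assumes D: "continuous_on UNIV D" "\<And>x. x \<notin> cball c r \<Longrightarrow> D x = 0"
    and \<rho>: "continuous_on UNIV \<rho>"
    and t: "t \<longlonglongrightarrow> 0" "\<And>n. t n \<noteq> 0" "\<And>n x. \<bar>t n * D x\<bar> \<le> 1 / 2"
  shows "(\<lambda>n. \<integral>x. \<rho> x * (ln (1 + t n * D x) / t n) \<partial>lborel) \<longlonglongrightarrow> (\<integral>x. \<rho> x * D x \<partial>lborel)"
proof -
  define C where "C = (\<integral>x. \<bar>\<rho> x\<bar> * (2 * (D x)\<^sup>2) \<partial>lborel)"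
  have int: "integrable lborel (\<lambda>x. \<rho> x * (ln (1 + t n * D x) / t n))"
    "integrable lborel (\<lambda>x. \<rho> x * D x)" "integrable lborel (\<lambda>x. \<bar>\<rho> x\<bar> * (2 * (D x)\<^sup>2))" for n
  proof -
    have "1 + t n * D x > 0" for x
      using t(3)[of n x] by linarith
    then have "continuous_on UNIV (\<lambda>x. \<rho> x * (ln (1 + t n * D x) / t n))"
      using t(2)[of n] by (intro continuous_intros D \<rho>) (auto simp: less_imp_neq[THEN not_sym])
    then show "integrable lborel (\<lambda>x. \<rho> x * (ln (1 + t n * D x) / t n))"
      by (rule integrable_continuous_support[where c = c and r = r]) (simp add: D(2))
    show "integrable lborel (\<lambda>x. \<rho> x * D x)" "integrable lborel (\<lambda>x. \<bar>\<rho> x\<bar> * (2 * (D x)\<^sup>2))"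
      by (rule integrable_continuous_support[where c = c and r = r];
          auto intro!: continuous_intros D(1) \<rho> simp: D(2))+
  qed
  have bound: "\<bar>(\<integral>x. \<rho> x * (ln (1 + t n * D x) / t n) \<partial>lborel) - (\<integral>x. \<rho> x * D x \<partial>lborel)\<bar> \<le> \<bar>t n\<bar> * C" for n
  proof -
    have "\<bar>\<rho> x * (ln (1 + t n * D x) / t n) - \<rho> x * D x\<bar> \<le> \<bar>t n\<bar> * (\<bar>\<rho> x\<bar> * (2 * (D x)\<^sup>2))" for x
    proof -
      have "\<bar>ln (1 + t n * D x) / t n - D x\<bar> = \<bar>ln (1 + t n * D x) - t n * D x\<bar> / \<bar>t n\<bar>"
        using t(2)[of n] by (simp add: diff_divide_distrib flip: abs_divide)
      also have "\<dots> \<le> 2 * (t n * D x)\<^sup>2 / \<bar>t n\<bar>"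
        by (intro divide_right_mono abs_ln_one_plus_x_minus_x_bound t(3)) simp
      also have "\<dots> = \<bar>t n\<bar> * (2 * (D x)\<^sup>2)"
      proof -
        have "(t n * D x)\<^sup>2 = \<bar>t n\<bar> * (\<bar>t n\<bar> * (D x)\<^sup>2)"
          by (simp add: power_mult_distrib power2_eq_square flip: mult.assoc)
        then show ?thesis
          using t(2)[of n] by simp
      qed
      finally have "\<bar>\<rho> x\<bar> * \<bar>ln (1 + t n * D x) / t n - D x\<bar> \<le> \<bar>\<rho> x\<bar> * (\<bar>t n\<bar> * (2 * (D x)\<^sup>2))"
        by (rule mult_left_mono) simp
      moreover have "\<bar>\<rho> x * (ln (1 + t n * D x) / t n) - \<rho> x * D x\<bar> = \<bar>\<rho> x\<bar> * \<bar>ln (1 + t n * D x) / t n - D x\<bar>"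
        by (metis abs_mult right_diff_distrib)
      ultimately show ?thesis
        by (simp only: mult.left_commute)
    qed
    then have "(\<integral>x. \<bar>\<rho> x * (ln (1 + t n * D x) / t n) - \<rho> x * D x\<bar> \<partial>lborel) \<le>
        (\<integral>x. \<bar>t n\<bar> * (\<bar>\<rho> x\<bar> * (2 * (D x)\<^sup>2)) \<partial>lborel)"
      by (intro integral_mono integrable_abs Bochner_Integration.integrable_diff int integrable_mult_right)
    then show ?thesis
      using integral_abs_bound[of lborel "\<lambda>x. \<rho> x * (ln (1 + t n * D x) / t n) - \<rho> x * D x"]
      unfolding C_def Bochner_Integration.integral_diff[OF int(1,2)] integral_mult_right_zero by linarith
  qed
  have lim: "(\<lambda>n. \<bar>t n\<bar> * C) \<longlonglongrightarrow> 0"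
    using t(1) by (auto intro!: tendsto_eq_intros)
  have "(\<lambda>n. (\<integral>x. \<rho> x * (ln (1 + t n * D x) / t n) \<partial>lborel) - (\<integral>x. \<rho> x * D x \<partial>lborel)) \<longlonglongrightarrow> 0"
    by (rule Lim_null_comparison[OF always_eventually lim]) (simp only: real_norm_def bound simp_thms)
  then show ?thesis
    by (simp only: LIM_zero_iff)
qed

text \<open>The chain rule splits the log-determinant, and expanding the squares around
  \<open>A x\<close> leaves \<open>y\<close> only in a term linear in \<open>y - A x\<close>, which
  \<open>joint_law_integral\<close> averages out.\<close>

lemma logdet_integrand_shear:
  fixes \<phi> :: "real^'n \<Rightarrow> real^'n" and g :: "real^'n \<Rightarrow> real"
  assumes \<phi>: "\<phi> \<in> Diff2" and g: "\<And>x. GDERIV g x :> G x" and pos: "\<And>x. 0 < 1 + G x $ k"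
  defines "w \<equiv> \<lambda>x. ln \<bar>det (jacobian \<phi> (at x))\<bar>" and "S \<equiv> \<lambda>x. x + g x *\<^sub>R axis k 1"
  shows "logdet_integrand \<delta>' (\<lambda>x. \<phi> (S x)) (x, y) = logdet_integrand \<delta>' \<phi> (x, y) +
    ((norm (\<phi> (S x) - A x))\<^sup>2 / 2 - (norm (\<phi> x - A x))\<^sup>2 / 2
      - \<delta>'\<^sup>2 * (w (S x) - w x + ln (1 + G x $ k)) + (y - A x) \<bullet> (\<phi> x - \<phi> (S x)))"
proof -
  have "(S has_derivative (\<lambda>h. h + (h \<bullet> G x) *\<^sub>R axis k 1)) (at x)"
    using g[of x] unfolding S_def gderiv_def by (auto intro!: derivative_eq_intros)
  then have "S differentiable (at x)"
    by (auto simp: differentiable_def)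
  then have "det (jacobian (\<lambda>x. \<phi> (S x)) (at x)) = det (jacobian \<phi> (at (S x))) * (1 + G x $ k)"
    using det_jacobian_shear[OF g, where x = x and k = k] det_jacobian_compose[of \<phi> S x] Diff2_C1(3)[OF \<phi>]
    by (simp add: S_def)
  then have "ln \<bar>det (jacobian (\<lambda>x. \<phi> (S x)) (at x))\<bar> = w (S x) + ln (1 + G x $ k)"
    using pos[of x] det_jacobian_nonzero[OF \<phi>, of "S x"] by (simp add: w_def abs_mult ln_mult)
  moreover have "(norm (\<phi> (S x) - y))\<^sup>2 - (norm (\<phi> x - y))\<^sup>2 =
      (norm (\<phi> (S x) - A x))\<^sup>2 - (norm (\<phi> x - A x))\<^sup>2 + 2 * ((y - A x) \<bullet> (\<phi> x - \<phi> (S x)))"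
    unfolding power2_norm_eq_inner by (simp add: algebra_simps inner_commute)
  ultimately show ?thesis
    by (simp add: logdet_integrand_def w_def field_simps)
qed

text \<open>Minimality makes the change of the loss nonnegative along shears of either sign.
  Dividing by the step and letting it tend to 0 from both sides forces the derivative to
  vanish.\<close>

lemma weak_euler_lagrange:
  fixes A :: "real^'n \<Rightarrow> real^'n" and p g :: "real^'n \<Rightarrow> real"
  assumes A: "linear A" and \<delta>: "\<delta> > 0" and p: "continuous_on UNIV p" "\<And>x. p x > 0"
    and P: "prob_space (density lborel (\<lambda>x. ennreal (p x)))"
    and min: "is_arg_min (logdet_loss A \<delta> p \<delta>') (\<lambda>\<psi>. \<psi> \<in> logdet_admissible A \<delta> p \<delta>') \<phi>"
    and g: "\<And>x. GDERIV g x :> G x" "C1_map G"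
    and supp: "\<And>x. x \<notin> cball c r \<Longrightarrow> g x = 0" "\<And>x. x \<notin> cball c r \<Longrightarrow> G x = 0"
    and \<phi>': "\<And>x. (\<phi> has_derivative \<phi>' x) (at x)"
    and w': "\<And>x. ((\<lambda>x. ln \<bar>det (jacobian \<phi> (at x))\<bar>) has_derivative w' x) (at x)"
  shows "(\<integral>x. p x * ((\<phi> x - A x) \<bullet> \<phi>' x (g x *\<^sub>R axis k 1)) \<partial>lborel)
    - \<delta>'\<^sup>2 * (\<integral>x. p x * w' x (g x *\<^sub>R axis k 1) \<partial>lborel)
    - \<delta>'\<^sup>2 * (\<integral>x. p x * G x $ k \<partial>lborel) = 0"
proof -
  define w where "w x = ln \<bar>det (jacobian \<phi> (at x))\<bar>" for x
  let ?e = "axis k 1 :: real^'n"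
  define S where "S s x = x + (s * g x) *\<^sub>R ?e" for s x
  \<comment> \<open>\<open>cc\<close> is the part of the change of the integrand that survives
    averaging over the noise; \<open>u\<close> below is the coefficient of the noise.\<close>
  define cc where "cc s x = (norm (\<phi> (S s x) - A x))\<^sup>2 / 2 - (norm (\<phi> x - A x))\<^sup>2 / 2
      - \<delta>'\<^sup>2 * (w (S s x) - w x + ln (1 + s * G x $ k))" for s x
  define u where "u s x = \<phi> x - \<phi> (S s x)" for s x
  have \<phi>: "\<phi> \<in> Diff2" "integrable (joint_law A \<delta> p) (logdet_integrand \<delta>' \<phi>)"
    and opt: "\<And>\<psi>. \<psi> \<in> Diff2 \<Longrightarrow> integrable (joint_law A \<delta> p) (logdet_integrand \<delta>' \<psi>) \<Longrightarrow>
      logdet_loss A \<delta> p \<delta>' \<phi> \<le> logdet_loss A \<delta> p \<delta>' \<psi>"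
    using min by (auto simp: is_arg_min_linorder logdet_admissible_def)
  have \<phi>_C1: "C1_map \<phi>"
    using \<phi>(1) by (rule Diff2_C1)
  have w_C1: "C1_map w"
    unfolding w_def using \<phi>(1) det_jacobian_nonzero[OF \<phi>(1)]
    by (intro C1_map_ln_abs C1_map_det_jacobian) (auto simp: Diff2_def)
  have g_C1: "C1_map g"
    by (rule C1_map_GDERIV[OF g])
  have A_cont: "continuous_on UNIV A"
    using A by (simp add: linear_continuous_on linear_conv_bounded_linear)
  have cont: "continuous_on UNIV g" "continuous_on UNIV (\<lambda>x. G x $ k)"
    by (intro continuous_intros C1_map_continuous_on g_C1 g(2))+
  obtain M where M: "\<And>x. \<bar>g x\<bar> \<le> M"
    using continuous_bounded_support[OF cont(1) supp(1), unfolded real_norm_def] by blast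
  obtain B0 where B0: "\<And>x. norm (G x) \<le> B0"
    using continuous_bounded_support[OF C1_map_continuous_on[OF g(2)] supp(2)] by blast
  define b where "b = \<bar>B0\<bar> + 1"
  have b: "b \<ge> 1"
    by (simp add: b_def)
  \<comment> \<open>For steps up to \<open>s0\<close> the scaled gradient has norm at most 1/2, as
    the shear and the logarithm estimate require; \<open>b \<ge> 1\<close> also gives
    \<open>s0 \<le> 1\<close>, as the difference quotients require.\<close>
  define s0 where "s0 = 1 / (2 * b)"
  have s0: "s0 > 0" "s0 \<le> 1"
    using b by (auto simp: s0_def)
  have sG: "norm (s *\<^sub>R G x) \<le> 1 / 2" if "\<bar>s\<bar> \<le> s0" for s x
  proof -
    have "\<bar>s\<bar> * norm (G x) \<le> s0 * b"
      using that B0[of x] s0 b b_def by (intro mult_mono) auto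
    also have "\<dots> = 1 / 2"
      using b by (simp add: s0_def)
    finally show ?thesis
      by simp
  qed
  have sGk: "\<bar>s * G x $ k\<bar> \<le> 1 / 2" if "\<bar>s\<bar> \<le> s0" for s x
    using order_trans[OF component_le_norm_cart[of "s *\<^sub>R G x" k] sG[OF that]] by simp
  have pos: "0 < 1 + s * G x $ k" if "\<bar>s\<bar> \<le> s0" for s x
    using sGk[OF that, of x] by linarith
  have nz: "1 + s * G x $ k \<noteq> 0" if "\<bar>s\<bar> \<le> s0" for s x
    using pos[OF that, of x] by linarith
  have \<phi>_cont: "continuous_on UNIV \<phi>" and w_cont: "continuous_on UNIV w"
    by (rule C1_map_continuous_on, fact)+
  have S_cont: "continuous_on UNIV (S s)" for s
    unfolding S_def[abs_def] by (intro continuous_intros cont)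
  have comp_cont: "continuous_on UNIV (\<lambda>x. \<phi> (S s x))" "continuous_on UNIV (\<lambda>x. w (S s x))" for s
    by (rule continuous_on_compose2[OF C1_map_continuous_on[OF \<phi>_C1] S_cont subset_UNIV])
      (rule continuous_on_compose2[OF C1_map_continuous_on[OF w_C1] S_cont subset_UNIV])
  have nonneg: "0 \<le> (\<integral>x. p x * cc s x \<partial>lborel)" if s: "\<bar>s\<bar> \<le> s0" for s
  proof -
    let ?\<psi> = "\<lambda>x. \<phi> (S s x)"
    have sg: "GDERIV (\<lambda>x. s * g x) x :> s *\<^sub>R G x" for x
      using GDERIV_mult[OF GDERIV_const[of s x] g(1)] by simp
    have sG_C1: "C1_map (\<lambda>x. s *\<^sub>R G x)"
      by (intro C1_map_bilinear[OF bounded_bilinear_scaleR] C1_map_const g)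
    have "S s \<in> Diff2"
      unfolding S_def[abs_def] by (rule shear_Diff2[OF sg sG_C1 sG[OF s] norm_axis_1])
    then have \<psi>: "?\<psi> \<in> Diff2"
      by (rule Diff2_compose[OF \<phi>(1)])
    have cc_cont: "continuous_on UNIV (cc s)"
      unfolding cc_def[abs_def]
      by (intro continuous_intros comp_cont A_cont cont \<phi>_cont w_cont ballI nz[OF s]) simp_all
    have cc0: "cc s x = 0" if "x \<notin> cball c r" for x
      using supp[OF that] by (simp add: cc_def S_def)
    obtain K where cc: "\<And>x. \<bar>cc s x\<bar> \<le> K"
      using continuous_bounded_support[OF cc_cont cc0, unfolded real_norm_def] by blast
    have u_cont: "continuous_on UNIV (u s)"
      unfolding u_def[abs_def] by (intro continuous_intros comp_cont \<phi>_cont)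
    have u0: "u s x = 0" if "x \<notin> cball c r" for x
      using supp[OF that] by (simp add: u_def S_def)
    obtain L where u: "\<And>x. norm (u s x) \<le> L"
      using continuous_bounded_support[OF u_cont u0] by blast
    note J = joint_law_integral[OF A \<delta> p(1) less_imp_le[OF p(2)]
        P borel_measurable_continuous_onI[OF cc_cont] cc borel_measurable_continuous_onI[OF u_cont] u]
    \<comment> \<open>The competitor's integrand is that of \<open>\<phi>\<close> plus an integrable
      perturbation. Hence the competitor is admissible, and the two losses may be
      subtracted.\<close>
    have split: "logdet_integrand \<delta>' ?\<psi> = (\<lambda>z. logdet_integrand \<delta>' \<phi> z +
        (case z of (x, y) \<Rightarrow> cc s x + (y - A x) \<bullet> u s x))"
    proof
      show "logdet_integrand \<delta>' ?\<psi> z = logdet_integrand \<delta>' \<phi> z +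
        (case z of (x, y) \<Rightarrow> cc s x + (y - A x) \<bullet> u s x)" for z
        using logdet_integrand_shear[OF \<phi>(1) sg, of k \<delta>' "fst z" "snd z" A] pos[OF s]
        by (simp add: cc_def u_def S_def w_def split_beta)
    qed
    have "integrable (joint_law A \<delta> p) (logdet_integrand \<delta>' ?\<psi>)"
      unfolding split by (intro Bochner_Integration.integrable_add \<phi>(2) J(1))
    from opt[OF \<psi> this] show ?thesis
      unfolding logdet_loss_def split by (simp add: Bochner_Integration.integral_add[OF \<phi>(2) J(1)] J(2))
  qed
  define I where "I = (\<integral>x. p x * ((\<phi> x - A x) \<bullet> \<phi>' x (g x *\<^sub>R ?e)) \<partial>lborel)
    - \<delta>'\<^sup>2 * (\<integral>x. p x * w' x (g x *\<^sub>R ?e) \<partial>lborel) - \<delta>'\<^sup>2 * (\<integral>x. p x * G x $ k \<partial>lborel)"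
  have lim: "(\<lambda>n. (\<integral>x. p x * cc (t n) x \<partial>lborel) / t n) \<longlonglongrightarrow> I"
    if t: "t \<longlonglongrightarrow> 0" "\<And>n. t n \<noteq> 0" "\<And>n. \<bar>t n\<bar> \<le> s0" for t
  proof -
    \<comment> \<open>The shear moves the argument of \<open>\<phi>\<close> but not that of
      \<open>A\<close>. Separating half the squared norm of \<open>\<phi>\<close> from the inner
      product with \<open>A x\<close> leaves quotients of single C^1 functions against continuous
      weights.\<close>
    define N where "N x = \<phi> x \<bullet> \<phi> x / 2" for x
    have N_C1: "C1_map N"
      unfolding N_def[abs_def] divide_inverse
      by (intro C1_map_mult C1_map_const C1_map_bilinear[OF bounded_bilinear_inner] \<phi>_C1)
    have N': "(N has_derivative (\<lambda>h. \<phi> x \<bullet> \<phi>' x h)) (at x)" for x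
      unfolding N_def[abs_def] by (auto intro!: derivative_eq_intros \<phi>' simp: inner_commute)
    define q1 where "q1 n x = p x * ((N (S (t n) x) - N x) / t n)" for n x
    define q2 where "q2 n x = (p x *\<^sub>R A x) \<bullet> ((\<phi> (S (t n) x) - \<phi> x) /\<^sub>R t n)" for n x
    define q3 where "q3 n x = p x * ((w (S (t n) x) - w x) / t n)" for n x
    define q4 where "q4 n x = p x * (ln (1 + t n * G x $ k) / t n)" for n x
    have t1: "\<bar>t n\<bar> \<le> 1" for n
      using t(3)[of n] s0 by simp
    note L = LIMSEQ_integral_difference_quotient[OF _ _ _ borel_measurable_continuous_onI[OF cont(1)] M supp(1) t(1,2) t1,
        where a = ?e]
    have l1: "(\<lambda>n. \<integral>x. q1 n x \<partial>lborel) \<longlonglongrightarrow> (\<integral>x. p x * (\<phi> x \<bullet> \<phi>' x (g x *\<^sub>R ?e)) \<partial>lborel)"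
      using L[OF N_C1 N' p(1)] by (simp add: q1_def S_def divide_inverse_commute)
    have l2: "(\<lambda>n. \<integral>x. q2 n x \<partial>lborel) \<longlonglongrightarrow> (\<integral>x. (p x *\<^sub>R A x) \<bullet> \<phi>' x (g x *\<^sub>R ?e) \<partial>lborel)"
      unfolding q2_def S_def by (intro L \<phi>_C1 \<phi>' continuous_intros p A_cont)
    have l3: "(\<lambda>n. \<integral>x. q3 n x \<partial>lborel) \<longlonglongrightarrow> (\<integral>x. p x * w' x (g x *\<^sub>R ?e) \<partial>lborel)"
      using L[OF w_C1 w'[folded w_def] p(1)] by (simp add: q3_def S_def divide_inverse_commute)
    have l4: "(\<lambda>n. \<integral>x. q4 n x \<partial>lborel) \<longlonglongrightarrow> (\<integral>x. p x * G x $ k \<partial>lborel)"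
      unfolding q4_def using supp(2)
      by (intro LIMSEQ_integral_ln_quotient[where c = c and r = r] cont p t sGk) auto
    have int: "integrable lborel (q1 n)" "integrable lborel (q2 n)" "integrable lborel (q3 n)"
      "integrable lborel (q4 n)" for n
    proof -
      have N_cont: "continuous_on UNIV (\<lambda>x. N (S (t n) x))"
        by (rule continuous_on_compose2[OF C1_map_continuous_on[OF N_C1] S_cont]) auto
      have c: "continuous_on UNIV (q1 n)" "continuous_on UNIV (q2 n)" "continuous_on UNIV (q3 n)"
        unfolding q1_def[abs_def] q2_def[abs_def] q3_def[abs_def] 
        by (intro continuous_intros ballI t(2) comp_cont p A_cont N_cont \<phi>_cont w_cont
            C1_map_continuous_on[OF N_C1])+
      have c4: "continuous_on UNIV (q4 n)"
        unfolding q4_def[abs_def] 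
        by (intro continuous_intros p cont ballI nz[OF t(3)] t(2))
      show "integrable lborel (q1 n)" "integrable lborel (q2 n)" "integrable lborel (q3 n)"
        "integrable lborel (q4 n)"
        by (rule integrable_continuous_support[where c = c and r = r], fact,
            simp add: q1_def q2_def q3_def q4_def S_def supp)+
    qed
    have cc_eq: "cc s x = (N (S s x) - N x) - A x \<bullet> (\<phi> (S s x) - \<phi> x)
        - \<delta>'\<^sup>2 * ((w (S s x) - w x) + ln (1 + s * G x $ k))" for s x
      by (simp add: cc_def N_def power2_norm_eq_inner inner_commute inner_diff_left inner_diff_right
          field_simps)
    have "p x * cc (t n) x / t n = q1 n x - q2 n x - \<delta>'\<^sup>2 * q3 n x - \<delta>'\<^sup>2 * q4 n x" for n x
      unfolding cc_eq q1_def q2_def q3_def q4_def inner_scaleR_left inner_scaleR_right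
      by (simp add: right_diff_distrib distrib_left add_divide_distrib diff_divide_distrib
          inverse_eq_divide mult_ac)
    then have "(\<integral>x. p x * cc (t n) x \<partial>lborel) / t n =
      (\<integral>x. q1 n x - q2 n x - \<delta>'\<^sup>2 * q3 n x - \<delta>'\<^sup>2 * q4 n x \<partial>lborel)" for n
      by (simp only: integral_divide_zero[symmetric])
    then have eq: "(\<integral>x. p x * cc (t n) x \<partial>lborel) / t n = (\<integral>x. q1 n x \<partial>lborel) - (\<integral>x. q2 n x \<partial>lborel)
        - \<delta>'\<^sup>2 * (\<integral>x. q3 n x \<partial>lborel) - \<delta>'\<^sup>2 * (\<integral>x. q4 n x \<partial>lborel)" for n
      by (simp add: int)
    have \<phi>'_cont: "continuous_on UNIV (\<lambda>x. \<phi>' x (g x *\<^sub>R ?e))"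
      by (intro C1_map_continuous_on_derivative[OF \<phi>_C1 \<phi>'] continuous_intros cont)
    have \<phi>'_0: "\<phi>' x 0 = 0" for x
      using linear_0[OF has_derivative_linear[OF \<phi>']] .
    have "integrable lborel (\<lambda>x. p x * (\<phi> x \<bullet> \<phi>' x (g x *\<^sub>R ?e)))"
      "integrable lborel (\<lambda>x. (p x *\<^sub>R A x) \<bullet> \<phi>' x (g x *\<^sub>R ?e))"
      by (rule integrable_continuous_support[where c = c and r = r],
          intro continuous_intros \<phi>'_cont p A_cont \<phi>_cont, simp add: supp \<phi>'_0)+
    then have "I = (\<integral>x. p x * (\<phi> x \<bullet> \<phi>' x (g x *\<^sub>R ?e)) \<partial>lborel) - (\<integral>x. (p x *\<^sub>R A x) \<bullet> \<phi>' x (g x *\<^sub>R ?e) \<partial>lborel)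
        - \<delta>'\<^sup>2 * (\<integral>x. p x * w' x (g x *\<^sub>R ?e) \<partial>lborel) - \<delta>'\<^sup>2 * (\<integral>x. p x * G x $ k \<partial>lborel)"
      unfolding I_def by (subst Bochner_Integration.integral_diff[symmetric])
        (simp_all add: inner_diff_left right_diff_distrib)
    then show ?thesis
      unfolding eq by (simp only:) (intro tendsto_intros l1 l2 l3 l4)
  qed
  define t where "t n = s0 / real (Suc n)" for n
  have t: "t \<longlonglongrightarrow> 0" "0 < t n" "t n \<le> s0" for n
  proof -
    show "t \<longlonglongrightarrow> 0"
      unfolding t_def by real_asymp
    show "0 < t n" "t n \<le> s0"
      using s0 mult_left_mono[of 1 "real (Suc n)" s0] by (auto simp: t_def divide_le_eq)
  qed
  have "0 \<le> I"
  proof (rule LIMSEQ_le_const[OF lim[of t]])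
    show "\<exists>N. \<forall>n\<ge>N. 0 \<le> (\<integral>x. p x * cc (t n) x \<partial>lborel) / t n"
      using nonneg t by (auto intro!: divide_nonneg_pos simp: less_imp_le abs_of_pos)
  qed (use t in \<open>auto simp: less_imp_neq[THEN not_sym] abs_of_pos\<close>)
  \<comment> \<open>Along negative steps the numerator is still nonnegative while the divisor
    changes sign.\<close>
  moreover have "I \<le> 0"
  proof (rule LIMSEQ_le_const2[OF lim[of "\<lambda>n. - t n"]])
    show "\<exists>N. \<forall>n\<ge>N. (\<integral>x. p x * cc (- t n) x \<partial>lborel) / (- t n) \<le> 0"
      using nonneg t by (auto intro!: divide_nonneg_pos simp: less_imp_le abs_of_pos)
    show "(\<lambda>n. - t n) \<longlonglongrightarrow> 0"
      using tendsto_minus[OF t(1)] by simp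
  qed (use t in \<open>auto simp: less_imp_neq[THEN not_sym] abs_of_pos\<close>)
  ultimately show ?thesis
    by (simp add: I_def)
qed

section \<open>The fixed point equation\<close>

text \<open>Pointwise form of \<open>weak_euler_lagrange\<close>: integration by parts moves the
  derivative from the bump to \<open>p\<close>, localization removes the bump, and linearity extends
  the identity from the coordinate axes to every direction.\<close>

lemma euler_lagrange:
  fixes A :: "real^'n \<Rightarrow> real^'n" and p :: "real^'n \<Rightarrow> real"
  assumes A: "linear A" and \<delta>: "\<delta> > 0" and p: "C1_map p" "\<And>x. p x > 0"
    and P: "prob_space (density lborel (\<lambda>x. ennreal (p x)))"
    and min: "is_arg_min (logdet_loss A \<delta> p \<delta>') (\<lambda>\<psi>. \<psi> \<in> logdet_admissible A \<delta> p \<delta>') \<phi>"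
    and \<phi>': "\<And>x. (\<phi> has_derivative \<phi>' x) (at x)"
    and w': "\<And>x. ((\<lambda>x. ln \<bar>det (jacobian \<phi> (at x))\<bar>) has_derivative w' x) (at x)"
    and p': "\<And>x. (p has_derivative p' x) (at x)"
  shows "p x * ((\<phi> x - A x) \<bullet> \<phi>' x v) - \<delta>'\<^sup>2 * (p x * w' x v) + \<delta>'\<^sup>2 * p' x v = 0"
proof -
  have \<phi>: "\<phi> \<in> Diff2"
    using min by (auto simp: is_arg_min_linorder logdet_admissible_def)
  have \<phi>_C1: "C1_map \<phi>"
    using \<phi> by (rule Diff2_C1)
  have w_C1: "C1_map (\<lambda>x. ln \<bar>det (jacobian \<phi> (at x))\<bar>)"
    using \<phi> det_jacobian_nonzero[OF \<phi>]
    by (intro C1_map_ln_abs C1_map_det_jacobian) (auto simp: Diff2_def)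
  have A_cont: "continuous_on UNIV A"
    using A by (simp add: linear_continuous_on linear_conv_bounded_linear)
  note cont = A_cont C1_map_continuous_on[OF \<phi>_C1] C1_map_continuous_on[OF p(1)]
    C1_map_continuous_on[OF C1_map_bump] C1_map_continuous_on[OF C1_map_bump_grad]
    C1_map_continuous_on_derivative[OF \<phi>_C1 \<phi>' continuous_on_const]
    C1_map_continuous_on_derivative[OF w_C1 w' continuous_on_const]
    C1_map_continuous_on_derivative[OF p(1) p' continuous_on_const]
  have lin: "linear (\<phi>' x)" "linear (w' x)" "linear (p' x)" for x
    using \<phi>' w' p' by (blast intro: has_derivative_linear)+
  define l where "l x v = p x * ((\<phi> x - A x) \<bullet> \<phi>' x v) - \<delta>'\<^sup>2 * (p x * w' x v) + \<delta>'\<^sup>2 * p' x v" for x v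
  have axis: "l c (axis k 1) = 0" for c k
  proof (rule fundamental_lemma_bump[of "\<lambda>x. l x (axis k 1)" c])
    let ?e = "axis k 1 :: real^'n"
    show "continuous_on UNIV (\<lambda>x. l x ?e)"
      unfolding l_def by (intro continuous_intros cont)
    show "(\<integral>x. bump c r x * l x ?e \<partial>lborel) = 0" if r: "r > 0" for r
    proof -
      let ?g = "bump c r" and ?G = "bump_grad c r"
      define a1 where "a1 x = p x * ((\<phi> x - A x) \<bullet> \<phi>' x (?g x *\<^sub>R ?e))" for x
      define a2 where "a2 x = p x * w' x (?g x *\<^sub>R ?e)" for x
      define a3 where "a3 x = p x * ?G x $ k" for x
      define a4 where "a4 x = p' x ?e * ?g x" for x
      \<comment> \<open>Linearity of the derivatives pulls out the scalar bump, so that it becomes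
        the weight in the localization argument.\<close>
      have eq: "a1 x = p x * (?g x * ((\<phi> x - A x) \<bullet> \<phi>' x ?e))" "a2 x = p x * (?g x * w' x ?e)" for x
        by (simp_all add: a1_def a2_def linear_scale[OF lin(1)] linear_scale[OF lin(2)])
      have int: "integrable lborel a1" "integrable lborel a2" "integrable lborel a3" "integrable lborel a4"
      proof -
        have "continuous_on UNIV a1" "continuous_on UNIV a2" "continuous_on UNIV a3" "continuous_on UNIV a4"
          unfolding eq[abs_def] a3_def[abs_def] a4_def[abs_def] by (intro continuous_intros cont)+
        show "integrable lborel a1" "integrable lborel a2" "integrable lborel a3" "integrable lborel a4"
          by (rule integrable_continuous_support[where c = c and r = r], fact,
              simp add: eq a3_def a4_def bump_outside[OF r])+
      qed
      have EL: "(\<integral>x. a1 x \<partial>lborel) - \<delta>'\<^sup>2 * (\<integral>x. a2 x \<partial>lborel) - \<delta>'\<^sup>2 * (\<integral>x. a3 x \<partial>lborel) = 0"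
        unfolding a1_def a2_def a3_def
        by (rule weak_euler_lagrange[OF A \<delta> cont(3) p(2) P min GDERIV_bump C1_map_bump_grad
              bump_outside(1)[OF r] bump_outside(2)[OF r] \<phi>' w'])
      \<comment> \<open>Product rule for \<open>p\<close> times the bump; the zero integral of this
        derivative is the integration by parts.\<close>
      define D where "D x v = p x * (v \<bullet> ?G x) + p' x v * ?g x" for x v
      have "(\<integral>x. D x ?e \<partial>lborel) = 0"
      proof (rule integral_derivative_compact_support[where f = "\<lambda>x. p x * ?g x"])
        show "C1_map (\<lambda>x. p x * ?g x)"
          by (intro C1_map_mult p C1_map_bump)
        show "((\<lambda>x. p x * ?g x) has_derivative D x) (at x)" for x
          using GDERIV_bump[of c r x] p' unfolding gderiv_def D_def[abs_def] by (intro has_derivative_mult)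
        show "p x * ?g x = 0" if "x \<notin> cball c r" for x
          using bump_outside(1)[OF r that] by simp
      qed
      then have parts: "(\<integral>x. a3 x \<partial>lborel) + (\<integral>x. a4 x \<partial>lborel) = 0"
        using int by (simp add: D_def inner_axis' flip: a3_def a4_def)
      have "(\<integral>x. ?g x * l x ?e \<partial>lborel) = (\<integral>x. a1 x - \<delta>'\<^sup>2 * a2 x + \<delta>'\<^sup>2 * a4 x \<partial>lborel)"
        by (rule Bochner_Integration.integral_cong) (simp_all add: l_def eq a4_def algebra_simps)
      also have "\<dots> = (\<integral>x. a1 x \<partial>lborel) - \<delta>'\<^sup>2 * (\<integral>x. a2 x \<partial>lborel) + \<delta>'\<^sup>2 * (\<integral>x. a4 x \<partial>lborel)"
        using int by simp
      also have "(\<integral>x. a4 x \<partial>lborel) = - (\<integral>x. a3 x \<partial>lborel)"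
        using parts by linarith
      finally show ?thesis
        using EL by simp
    qed
  qed
  have "linear (l x)" for x
    unfolding l_def[abs_def]
    by (rule linearI) (simp_all add: linear_add[OF lin(1)] linear_add[OF lin(2)] linear_add[OF lin(3)]
        linear_scale[OF lin(1)] linear_scale[OF lin(2)] linear_scale[OF lin(3)] inner_add_right algebra_simps)
  moreover have "linear (\<lambda>_ :: real^'n. 0 :: real)"
    by (rule module_hom_zero)
  ultimately have "l x = (\<lambda>_. 0)" for x
    by (rule linear_eq_stdbasis) (auto simp: Basis_vec_def axis)
  then show ?thesis
    by (metis l_def)
qed

text \<open>The Jacobian determinants of \<open>\<phi>\<close> and its inverse are reciprocal, so
  the logarithm turns the volume factor into a difference.\<close>

lemma ln_pushforward_density:
  fixes p :: "real^'n \<Rightarrow> real"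
  assumes \<phi>: "\<phi> \<in> Diff2" and p: "\<And>x. p x > 0"
  shows "ln (pushforward_density \<phi> p y) = ln (p (inv \<phi> y)) - ln \<bar>det (jacobian \<phi> (at (inv \<phi> y)))\<bar>"
proof -
  let ?d = "det (jacobian \<phi> (at (inv \<phi> y)))"
  have d: "?d \<noteq> 0"
    by (rule det_jacobian_nonzero[OF \<phi>])
  then have "det (jacobian (inv \<phi>) (at y)) = inverse ?d"
    using det_jacobian_inv[OF \<phi>, of y] by (simp add: field_simps)
  then have "ln (pushforward_density \<phi> p y) = ln (p (inv \<phi> y) / \<bar>?d\<bar>)"
    by (simp add: pushforward_density_def abs_inverse divide_inverse)
  then show ?thesis
    using p[of "inv \<phi> y"] d by (simp add: ln_div)
qed

text \<open>The definite description is resolved by uniqueness: the difference of two representing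
  vectors is orthogonal to itself.\<close>

lemma gradient_eq:
  assumes "GDERIV f x :> D"
  shows "gradient f x = D"
  unfolding gradient_def
proof (rule the_equality)
  show "GDERIV f x :> D" by fact
next
  fix D' assume "GDERIV f x :> D'"
  then have "(\<lambda>h. h \<bullet> D') = (\<lambda>h. h \<bullet> D)"
    using assms has_derivative_unique unfolding gderiv_def by blast
  then have "(D' - D) \<bullet> (D' - D) = 0"
    by (metis inner_diff_right right_minus_eq)
  then show "D' = D" by simp
qed

text \<open>The value of \<open>gradient\<close> is specified only at points of differentiability,
  so differentiability of the log-density is part of the conclusion and gives the equation its
  meaning.\<close>

theorem theorem1:
  fixes A :: "real^'n \<Rightarrow> real^'n"
    and p :: "real^'n \<Rightarrow> real"
    and \<delta> \<delta>' :: real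
    and \<phi> :: "real^'n \<Rightarrow> real^'n"
  assumes "linear A"
    and "\<delta> > 0"
    and "\<delta>' > 0"
    and "C1_map p"
    and "\<And>x. p x > 0"
    and "prob_space (density lborel (\<lambda>x. ennreal (p x)))"
    and "is_arg_min (logdet_loss A \<delta> p \<delta>') (\<lambda>\<psi>. \<psi> \<in> logdet_admissible A \<delta> p \<delta>') \<phi>"
  shows "\<forall>x. (\<lambda>y. ln (pushforward_density \<phi> p y)) differentiable (at (\<phi> x)) \<and>
    \<phi> x = A x - \<delta>'\<^sup>2 *\<^sub>R gradient (\<lambda>y. ln (pushforward_density \<phi> p y)) (\<phi> x)"
proof
  fix x
  define w where "w x = ln \<bar>det (jacobian \<phi> (at x))\<bar>" for x
  have \<phi>: "\<phi> \<in> Diff2"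
    using assms(7) by (auto simp: is_arg_min_linorder logdet_admissible_def)
  have "C1_map w"
    unfolding w_def using \<phi> det_jacobian_nonzero[OF \<phi>]
    by (intro C1_map_ln_abs C1_map_det_jacobian) (auto simp: Diff2_def)
  then obtain w' where w': "\<And>x. (w has_derivative w' x) (at x)"
    by (elim C1_mapE) blast
  obtain \<phi>' where \<phi>': "\<And>x. (\<phi> has_derivative \<phi>' x) (at x)"
    using Diff2_C1(1)[OF \<phi>] by (elim C1_mapE) blast
  obtain p' where p': "\<And>x. (p has_derivative p' x) (at x)"
    using assms(4) by (elim C1_mapE) blast
  obtain J where J: "(inv \<phi> has_derivative J) (at (\<phi> x))"
    using Diff2_C1(4)[OF \<phi>] by (auto simp: differentiable_def)
  have bij: "bij \<phi>"
    using \<phi> by (simp add: Diff2_def)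
  then have inv: "inv \<phi> (\<phi> x) = x" "\<And>y. \<phi> (inv \<phi> y) = y"
    by (simp_all add: bij_is_inj inv_f_f bij_is_surj surj_f_inv_f)
  \<comment> \<open>Differentiating the identity shows \<open>J\<close> to be a right inverse of
    \<open>\<phi>' x\<close>. Testing the Euler-Lagrange equation in direction \<open>J v\<close>
    thus replaces \<open>\<phi>' x (J v)\<close> by \<open>v\<close>.\<close>
  have "((\<lambda>y. \<phi> (inv \<phi> y)) has_derivative (\<lambda>v. \<phi>' x (J v))) (at (\<phi> x))"
    using has_derivative_compose[OF J \<phi>'] by (simp add: inv)
  then have "(\<lambda>v. \<phi>' x (J v)) = (\<lambda>v. v)"
    unfolding inv(2) by (rule has_derivative_unique[OF _ has_derivative_ident])
  then have \<phi>'_J: "\<phi>' x (J v) = v" for v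
    by meson
  have "((\<lambda>y. ln (p (inv \<phi> y)) - w (inv \<phi> y)) has_derivative
      (\<lambda>v. p' x (J v) / p x - w' x (J v))) (at (\<phi> x))"
    using has_derivative_compose[OF J p'] has_derivative_compose[OF J w'] assms(5)[of x]
    by (auto intro!: derivative_eq_intros simp: inv divide_inverse)
  \<comment> \<open>Dividing the Euler-Lagrange equation by \<open>p x\<close> and
    \<open>\<delta>'\<^sup>2\<close>, both positive, exhibits the derivative of the log-density as
    an inner product and so identifies the gradient.\<close>
  moreover have "p' x (J v) / p x - w' x (J v) = v \<bullet> ((A x - \<phi> x) /\<^sub>R \<delta>'\<^sup>2)" for v
  proof -
    have "p x * ((\<phi> x - A x) \<bullet> v) - \<delta>'\<^sup>2 * (p x * w' x (J v)) + \<delta>'\<^sup>2 * p' x (J v) = 0"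
      using euler_lagrange[OF assms(1,2,4,5,6,7) \<phi>' w'[unfolded w_def[abs_def]] p', of x "J v"]
      by (simp only: \<phi>'_J)
    then have "p' x (J v) / p x - w' x (J v) = - ((\<phi> x - A x) \<bullet> v / \<delta>'\<^sup>2)"
      using assms(3) assms(5)[of x] by (simp add: field_simps)
    moreover have "v \<bullet> ((A x - \<phi> x) /\<^sub>R \<delta>'\<^sup>2) = - ((\<phi> x - A x) \<bullet> v / \<delta>'\<^sup>2)"
      by (simp add: inner_commute inner_diff_left divide_inverse algebra_simps)
    ultimately show ?thesis
      by simp
  qed
  ultimately have grad: "GDERIV (\<lambda>y. ln (pushforward_density \<phi> p y)) (\<phi> x) :> (A x - \<phi> x) /\<^sub>R \<delta>'\<^sup>2"
    unfolding gderiv_def ln_pushforward_density[OF \<phi> assms(5)] w_def by simp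
  then have "(\<lambda>y. ln (pushforward_density \<phi> p y)) differentiable (at (\<phi> x))"
    unfolding gderiv_def differentiable_def by blast
  then show "(\<lambda>y. ln (pushforward_density \<phi> p y)) differentiable (at (\<phi> x)) \<and>
    \<phi> x = A x - \<delta>'\<^sup>2 *\<^sub>R gradient (\<lambda>y. ln (pushforward_density \<phi> p y)) (\<phi> x)"
    using assms(3) by (simp add: gradient_eq[OF grad])
qed

end
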